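(* Let $A$ be a uT-algebra which is weakly regular and functionally continuous. Let $B$ be an lmc algebra and let $\Phi: A \to B$ be an injective algebra homomorphism such that $C := \overline{\operatorname{Im}\Phi}$ (closure in $B$, with the topology induced by $B$) is a Q-algebra. Then the following are equivalent: (1) the map $\Phi^{-1}|_{\operatorname{Im}\Phi} : \operatorname{Im}\Phi \to A$ is continuous, where $\operatorname{Im}\Phi$ carries the topology induced by $B$; (2) $\operatorname{Im}\Phi$ (with the topology induced by $B$) is functionally continuous; (3) the map $\Phi^*: M(C) \to M(A)$, $\Phi^*(f) = f\circ\Phi$, is surjective; (4) $\operatorname{Im}\Phi \cap R(C) = \{0\}$.
   Context: All algebras are complex, commutative and have a unit. A topological algebra is an algebra that is also a Hausdorff topological vector space in which multiplication is separately continuous. An lmc algebra is a topological algebra whose topology is determined by a family of submultiplicative seminorms. A uniform seminorm on an algebra is a seminorm $p$ with $p(x^2)=p(x)^2$ for all $x$; a uT-algebra is a topological algebra whose topology is determined by a family of uniform seminorms. For an algebra $A$, $M^*(A)$ is the set of all nonzero multiplicative linear functionals on $A$; for a topological algebra $A$, $M(A)$ is the set of nonzero continuous multiplicative linear functionals. A topological algebra $A$ is functionally continuous if $M^*(A)=M(A)$. A topological algebra is a Q-algebra if its set of invertible elements is open. A topological algebra $A$ is weakly regular if for every closed subset $F \subsetneq M(A)$ (with the weak* topology) there is a nonzero $x\in A$ with $f(x)=0$ for all $f\in F$. $R(C)$ denotes the (Jacobson) radical of the algebra $C$. *)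

theory Defs
  imports "HOL-Analysis.Analysis"
begin

class calg = comm_ring_1 +
  fixes smultC :: "complex \<Rightarrow> 'a \<Rightarrow> 'a"
  assumes smultC_add_right: "smultC a (x + y) = smultC a x + smultC a y"
    and smultC_add_left: "smultC (a + b) x = smultC a x + smultC b x"
    and smultC_assoc: "smultC a (smultC b x) = smultC (a * b) x"
    and smultC_one: "smultC 1 x = x"
    and smultC_mult_left: "smultC a x * y = smultC a (x * y)"

text \<open>Unital subalgebras of an ambient algebra (the carrier of an algebra).\<close>
definition subalgebra :: "'a::calg set \<Rightarrow> bool" where
  "subalgebra S \<longleftrightarrow> 1 \<in> S \<and> (\<forall>x\<in>S. \<forall>y\<in>S. x + y \<in> S \<and> x * y \<in> S)
      \<and> (\<forall>c. \<forall>x\<in>S. smultC c x \<in> S)"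

definition alg_hom :: "('a::calg \<Rightarrow> 'b::calg) \<Rightarrow> bool" where
  "alg_hom \<Phi> \<longleftrightarrow> (\<forall>x y. \<Phi> (x + y) = \<Phi> x + \<Phi> y) \<and> (\<forall>x y. \<Phi> (x * y) = \<Phi> x * \<Phi> y)
      \<and> (\<forall>c x. \<Phi> (smultC c x) = smultC c (\<Phi> x)) \<and> \<Phi> 1 = 1"

definition topological_algebra :: "'a::calg set \<Rightarrow> 'a topology \<Rightarrow> bool" where
  "topological_algebra S T \<longleftrightarrow> subalgebra S \<and> topspace T = S \<and> Hausdorff_space T
     \<and> continuous_map (prod_topology T T) T (\<lambda>(x, y). x + y)
     \<and> continuous_map (prod_topology (euclidean :: complex topology) T) T (\<lambda>(c, x). smultC c x)
     \<and> (\<forall>a\<in>S. continuous_map T T (\<lambda>x. a * x))"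

definition seminorm_on :: "'a::calg set \<Rightarrow> ('a \<Rightarrow> real) \<Rightarrow> bool" where
  "seminorm_on S p \<longleftrightarrow> (\<forall>x\<in>S. 0 \<le> p x) \<and> (\<forall>x\<in>S. \<forall>y\<in>S. p (x + y) \<le> p x + p y)
     \<and> (\<forall>c. \<forall>x\<in>S. p (smultC c x) = cmod c * p x)"

definition submultiplicative_on :: "'a::calg set \<Rightarrow> ('a \<Rightarrow> real) \<Rightarrow> bool" where
  "submultiplicative_on S p \<longleftrightarrow> (\<forall>x\<in>S. \<forall>y\<in>S. p (x * y) \<le> p x * p y)"

definition uniform_on :: "'a::calg set \<Rightarrow> ('a \<Rightarrow> real) \<Rightarrow> bool" where
  "uniform_on S p \<longleftrightarrow> (\<forall>x\<in>S. p (x ^ 2) = (p x) ^ 2)"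

definition seminorm_topology :: "'a::calg set \<Rightarrow> ('a \<Rightarrow> real) set \<Rightarrow> 'a topology" where
  "seminorm_topology S P = topology (\<lambda>U. U \<subseteq> S \<and> (\<forall>x\<in>U. \<exists>F e. finite F \<and> F \<subseteq> P \<and> 0 < e
      \<and> {y\<in>S. \<forall>p\<in>F. p (y - x) < e} \<subseteq> U))"

definition lmc_algebra :: "'a::calg set \<Rightarrow> 'a topology \<Rightarrow> bool" where
  "lmc_algebra S T \<longleftrightarrow> topological_algebra S T \<and>
     (\<exists>P. (\<forall>p\<in>P. seminorm_on S p \<and> submultiplicative_on S p) \<and> T = seminorm_topology S P)"

definition uT_algebra :: "'a::calg set \<Rightarrow> 'a topology \<Rightarrow> bool" where
  "uT_algebra S T \<longleftrightarrow> topological_algebra S T \<and>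
     (\<exists>P. (\<forall>p\<in>P. seminorm_on S p \<and> uniform_on S p) \<and> T = seminorm_topology S P)"

text \<open>M*(S): nonzero multiplicative linear functionals on S (values off S irrelevant).\<close>
definition Mstar :: "'a::calg set \<Rightarrow> ('a \<Rightarrow> complex) set" where
  "Mstar S = {f. (\<forall>x\<in>S. \<forall>y\<in>S. f (x + y) = f x + f y) \<and> (\<forall>c. \<forall>x\<in>S. f (smultC c x) = c * f x)
      \<and> (\<forall>x\<in>S. \<forall>y\<in>S. f (x * y) = f x * f y) \<and> (\<exists>x\<in>S. f x \<noteq> 0)}"

definition Mcont :: "'a::calg set \<Rightarrow> 'a topology \<Rightarrow> ('a \<Rightarrow> complex) set" where
  "Mcont S T = {f \<in> Mstar S. continuous_map T (euclidean :: complex topology) f}"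

definition functionally_continuous :: "'a::calg set \<Rightarrow> 'a topology \<Rightarrow> bool" where
  "functionally_continuous S T \<longleftrightarrow> Mstar S = Mcont S T"

definition q_algebra :: "'a::calg set \<Rightarrow> 'a topology \<Rightarrow> bool" where
  "q_algebra S T \<longleftrightarrow> openin T {x\<in>S. \<exists>y\<in>S. x * y = 1}"

definition weak_star_topology :: "'a::calg set \<Rightarrow> 'a topology \<Rightarrow> ('a \<Rightarrow> complex) topology" where
  "weak_star_topology S T = pullback_topology (Mcont S T) (\<lambda>f. restrict f S)
      (product_topology (\<lambda>_. (euclidean :: complex topology)) S)"

definition weakly_regular :: "'a::calg set \<Rightarrow> 'a topology \<Rightarrow> bool" where
  "weakly_regular S T \<longleftrightarrow> (\<forall>F. closedin (weak_star_topology S T) F \<and> F \<noteq> Mcont S T \<longrightarrow>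
      (\<exists>x\<in>S. x \<noteq> 0 \<and> (\<forall>f\<in>F. f x = 0)))"

definition alg_ideal :: "'a::calg set \<Rightarrow> 'a set \<Rightarrow> bool" where
  "alg_ideal S I \<longleftrightarrow> I \<subseteq> S \<and> 0 \<in> I \<and> (\<forall>x\<in>I. \<forall>y\<in>I. x + y \<in> I)
     \<and> (\<forall>c. \<forall>x\<in>I. smultC c x \<in> I) \<and> (\<forall>a\<in>S. \<forall>x\<in>I. a * x \<in> I)"

definition maximal_ideal :: "'a::calg set \<Rightarrow> 'a set \<Rightarrow> bool" where
  "maximal_ideal S I \<longleftrightarrow> alg_ideal S I \<and> I \<noteq> S \<and>
     (\<forall>J. alg_ideal S J \<and> I \<subseteq> J \<and> J \<noteq> S \<longrightarrow> J = I)"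

definition jacobson_radical :: "'a::calg set \<Rightarrow> 'a set" where
  "jacobson_radical S = {x\<in>S. \<forall>I. maximal_ideal S I \<longrightarrow> x \<in> I}"

end

theory Submission
  imports Defs
begin

text \<open>
  A uniform seminorm \<open>p\<close> is automatically submultiplicative, and for every \<open>x\<close> with \<open>p x > 0\<close> there
  is a character \<open>f\<close> with \<open>\<bar>f\<bar> \<le> p\<close> and \<open>\<bar>f x\<bar> = p x\<close>. No completeness is needed: replacing \<open>p\<close> by
  \<open>a \<mapsto> lim p (a x\<^sup>n) / p x\<^sup>n\<close> makes it multiplicative in the direction of \<open>x\<close>, a Zorn-minimal uniform
  seminorm below it is multiplicative, and a multiplicative seminorm \<open>q\<close> is the modulus of a
  character, because the minimum of \<open>\<lambda> \<mapsto> q (x - \<lambda>)\<close> cannot be positive.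

  In the Q-algebra \<open>C\<close> some continuous submultiplicative seminorm \<open>P\<close> satisfies: \<open>1 - x\<close> is invertible
  whenever \<open>P x < 1\<close>. Hence all characters of \<open>C\<close> are bounded by \<open>P\<close>, and every proper ideal \<open>I\<close> is
  killed by a character, namely one dominated by the spectral seminorm of the quotient seminorm of
  \<open>P\<close> modulo \<open>I\<close>. So the characters \<open>f \<circ> \<Phi>\<close> with \<open>f\<close> in \<open>M(C)\<close> are exactly the \<open>g\<close> in \<open>M(A)\<close> with
  \<open>\<bar>g x\<bar> \<le> P (\<Phi> x)\<close> for all \<open>x\<close>; such \<open>g\<close> extend to \<open>C\<close> by density. This is a weak* closed set. By
  weak regularity, if it is not all of \<open>M(A)\<close> then some \<open>\<Phi> x \<noteq> 0\<close> lies in \<open>R(C)\<close>; if it is, then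
  \<open>p x \<le> P (\<Phi> x)\<close> for each defining seminorm \<open>p\<close> of \<open>A\<close>, so the inverse of \<open>\<Phi>\<close> is continuous.
\<close>

section \<open>Uniform seminorms\<close>

text \<open>Rewriting the scalar action as a ring product lets \<open>algebra_simps\<close> handle
  scalars.\<close>

lemma smultC_conv_mult: "smultC c x = smultC c 1 * (x::'a::calg)"
  by (simp add: smultC_mult_left)

lemma smultC_zero_left [simp]: "smultC 0 (x::'a::calg) = 0"
  using smultC_add_left[of 0 0 x] by simp

lemma smultC_zero_right [simp]: "smultC c (0::'a::calg) = 0"
  using smultC_add_right[of c 0 0] by simp

lemma smultC_minus_left: "smultC (- c) (x::'a::calg) = - smultC c x"
  using smultC_add_left[of c "- c" x] by (simp add: eq_neg_iff_add_eq_0 add.commute)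

lemma smultC_minus_one: "smultC (- 1) (x::'a::calg) = - x"
  by (simp add: smultC_minus_left smultC_one)

lemma smultC_diff_left: "smultC (a - b) (x::'a::calg) = smultC a x - smultC b x"
  using smultC_add_left[of a "- b" x] by (simp add: smultC_minus_left)

lemma smultC_one_mult: "smultC (a * b) (1::'a::calg) = smultC a 1 * smultC b 1"
  by (metis smultC_assoc smultC_conv_mult)

lemma smultC_power: "(smultC c (x::'a::calg)) ^ n = smultC (c ^ n) (x ^ n)"
proof (induction n)
  case (Suc n)
  have "smultC c x * smultC (c ^ n) (x ^ n) = smultC (c * c ^ n) (x * x ^ n)"
    by (metis mult.commute smultC_assoc smultC_mult_left)
  then show ?case using Suc by simp
qed (simp add: smultC_one)

lemma smultC_of_nat: "smultC (of_nat n) (x::'a::calg) = of_nat n * x"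
  by (induction n) (simp_all add: smultC_add_left smultC_one algebra_simps)

lemma subalgebra_UNIV: "subalgebra UNIV"
  by (simp add: subalgebra_def)

section \<open>Subalgebras and elementary seminorm estimates\<close>

context
  fixes S :: "'a::calg set"
  assumes S: "subalgebra S"
begin

lemma subalgebra_one: "1 \<in> S"
  and subalgebra_add: "x \<in> S \<Longrightarrow> y \<in> S \<Longrightarrow> x + y \<in> S"
  and subalgebra_mult: "x \<in> S \<Longrightarrow> y \<in> S \<Longrightarrow> x * y \<in> S"
  and subalgebra_smultC: "x \<in> S \<Longrightarrow> smultC c x \<in> S"
  using S by (auto simp: subalgebra_def)

lemma subalgebra_zero: "0 \<in> S"
  using subalgebra_smultC[OF subalgebra_one, of 0] by simp

lemma subalgebra_minus: "x \<in> S \<Longrightarrow> - x \<in> S"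
  using subalgebra_smultC[of x "-1"] by (simp add: smultC_minus_one)

lemma subalgebra_diff: "x \<in> S \<Longrightarrow> y \<in> S \<Longrightarrow> x - y \<in> S"
  using subalgebra_add[of x "- y"] subalgebra_minus by simp

lemma subalgebra_power: "x \<in> S \<Longrightarrow> x ^ n \<in> S"
  by (induction n) (auto intro: subalgebra_one subalgebra_mult)

lemmas subalgebra_closed =
  subalgebra_one subalgebra_zero subalgebra_add subalgebra_mult subalgebra_smultC subalgebra_minus
  subalgebra_diff subalgebra_power

lemma seminorm_nonneg: "seminorm_on S p \<Longrightarrow> x \<in> S \<Longrightarrow> 0 \<le> p x"
  and seminorm_add: "seminorm_on S p \<Longrightarrow> x \<in> S \<Longrightarrow> y \<in> S \<Longrightarrow> p (x + y) \<le> p x + p y"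
  and seminorm_smultC: "seminorm_on S p \<Longrightarrow> x \<in> S \<Longrightarrow> p (smultC c x) = cmod c * p x"
  by (auto simp: seminorm_on_def)

lemma seminorm_zero: "seminorm_on S p \<Longrightarrow> p 0 = 0"
  using seminorm_smultC[of p 0 0] subalgebra_zero by simp

lemma seminorm_minus: "seminorm_on S p \<Longrightarrow> x \<in> S \<Longrightarrow> p (- x) = p x"
  using seminorm_smultC[of p x "-1"] by (simp add: smultC_minus_one)

lemma seminorm_diff: "seminorm_on S p \<Longrightarrow> x \<in> S \<Longrightarrow> y \<in> S \<Longrightarrow> p (x - y) \<le> p x + p y"
  using seminorm_add[of p x "- y"] seminorm_minus[of p y] subalgebra_minus[of y] by simp

lemma seminorm_minus_commute:
  "seminorm_on S p \<Longrightarrow> x \<in> S \<Longrightarrow> y \<in> S \<Longrightarrow> p (x - y) = p (y - x)"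
  using seminorm_minus[of p "x - y"] by (simp add: subalgebra_diff)

lemma seminorm_diff_ge: "seminorm_on S p \<Longrightarrow> x \<in> S \<Longrightarrow> y \<in> S \<Longrightarrow> p x - p y \<le> p (x - y)"
  using seminorm_add[of p "x - y" y] by (simp add: subalgebra_diff)

lemma seminorm_triangle_diff:
  "seminorm_on S p \<Longrightarrow> x \<in> S \<Longrightarrow> y \<in> S \<Longrightarrow> z \<in> S \<Longrightarrow> p (x - z) \<le> p (x - y) + p (y - z)"
  using seminorm_add[of p "x - y" "y - z"] by (simp add: subalgebra_diff)

text \<open>The scalar \<open>1 / c\<close> applied to \<open>smultC c x\<close> yields the reverse
  inequality, so one half of homogeneity suffices.\<close>

lemma seminorm_onI:
  assumes "\<And>x. x \<in> S \<Longrightarrow> 0 \<le> p x"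
    and "\<And>x y. x \<in> S \<Longrightarrow> y \<in> S \<Longrightarrow> p (x + y) \<le> p x + p y"
    and le: "\<And>c x. x \<in> S \<Longrightarrow> p (smultC c x) \<le> cmod c * p x"
  shows "seminorm_on S p"
  unfolding seminorm_on_def
proof (intro conjI ballI allI)
  fix c x assume x: "x \<in> S"
  show "p (smultC c x) = cmod c * p x"
  proof (rule antisym[OF le[OF x]])
    show "cmod c * p x \<le> p (smultC c x)"
    proof (cases "c = 0")
      case True then show ?thesis using assms(1)[OF subalgebra_zero] by simp
    next
      case False
      then show ?thesis
        using le[OF subalgebra_smultC[OF x], of "1 / c" c]
        by (simp add: smultC_assoc smultC_one norm_divide field_simps)
    qed
  qed
qed (use assms in auto)

lemma submult_power_le:
  assumes "seminorm_on S p" "submultiplicative_on S p" "x \<in> S"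
  shows "p (x ^ n) \<le> p 1 * p x ^ n"
proof (induction n)
  case (Suc n)
  have "p (x ^ Suc n) \<le> p (x ^ n) * p x"
    using assms subalgebra_closed by (simp add: submultiplicative_on_def mult.commute)
  also have "\<dots> \<le> p 1 * p x ^ n * p x"
    using Suc seminorm_nonneg assms by (intro mult_right_mono) auto
  finally show ?case by (simp add: mult_ac)
qed simp

text \<open>For a positive exponent the factor \<open>p 1\<close> disappears; submultiplicativity
  alone does not bound it by 1.\<close>

lemma submult_power_le':
  assumes "seminorm_on S p" "submultiplicative_on S p" "x \<in> S" "0 < n"
  shows "p (x ^ n) \<le> p x ^ n"
  using assms(4)
proof (induction n rule: nat_induct_non_zero)
  case (Suc n)
  have "p (x ^ Suc n) \<le> p x * p (x ^ n)"
    using assms subalgebra_closed by (simp add: submultiplicative_on_def)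
  also have "\<dots> \<le> p x * p x ^ n"
    using Suc seminorm_nonneg assms by (intro mult_left_mono) auto
  finally show ?case by simp
qed simp

lemma uniform_power2n:
  assumes "uniform_on S p" "x \<in> S"
  shows "p (x ^ (2 ^ n)) = p x ^ (2 ^ n)"
proof (induction n)
  case (Suc n)
  have "p ((x ^ (2 ^ n)) ^ 2) = p (x ^ (2 ^ n)) ^ 2"
    using assms subalgebra_closed by (simp add: uniform_on_def)
  then show ?case using Suc by (simp add: power_mult [symmetric] mult.commute)
qed simp

end

text \<open>If \<open>r > 1\<close>, then \<open>r ^ (2 ^ n)\<close> dominates the unbounded
  \<open>r ^ n\<close>. This removes a multiplicative constant from an estimate that holds for all
  \<open>2 ^ n\<close>-th powers.\<close>

lemma power2n_bounded_imp_le_one: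
  fixes r K :: real
  assumes "\<And>n. r ^ (2 ^ n) \<le> K"
  shows "r \<le> 1"
proof (rule ccontr)
  assume r: "\<not> r \<le> 1"
  then obtain k where "K < r ^ k" using real_arch_pow[of r K] by auto
  also have "r ^ k \<le> r ^ (2 ^ k)" using r by (intro power_increasing) auto
  finally show False using assms[of k] by simp
qed

text \<open>Strict upper bounds of nonnegative quantities are positive, so one may divide by them
  even where the quantity itself vanishes.\<close>

lemma le_mult_by_approx:
  fixes r s t :: real
  assumes "\<And>s' t'. s < s' \<Longrightarrow> t < t' \<Longrightarrow> r \<le> s' * t'"
  shows "r \<le> s * t"
proof (rule LIMSEQ_le_const)
  have *: "(\<lambda>n. a + 1 / real (Suc n)) \<longlonglongrightarrow> a" for a :: real
    using tendsto_add[OF tendsto_const LIMSEQ_Suc[OF lim_const_over_n[of "1::real"]], of a] by simp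
  show "(\<lambda>n. (s + 1 / real (Suc n)) * (t + 1 / real (Suc n))) \<longlonglongrightarrow> s * t"
    by (intro tendsto_mult *)
  show "\<exists>N. \<forall>n\<ge>N. r \<le> (s + 1 / real (Suc n)) * (t + 1 / real (Suc n))"
    using assms by simp
qed

text \<open>Polarisation, \<open>4xy = (x + y)^2 - (x - y)^2\<close>, bounds
  \<open>p (x * y)\<close> by 2 when \<open>p x\<close> and \<open>p y\<close> are at most 1.
  Scaling gives submultiplicativity up to the factor 2, and applying this to \<open>2 ^ n\<close>-th
  powers removes the factor.\<close>

lemma uniform_imp_submultiplicative:
  fixes S :: "'a::calg set"
  assumes S: "subalgebra S" and p: "seminorm_on S p" and u: "uniform_on S p"
  shows "submultiplicative_on S p"
  unfolding submultiplicative_on_def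
proof (intro ballI)
  note cl = subalgebra_closed[OF S]
  have two: "p (x * y) \<le> 2" if xy: "x \<in> S" "y \<in> S" and "p x \<le> 1" "p y \<le> 1" for x y
  proof -
    have "smultC 4 (x * y) = (x + y)^2 - (x - y)^2"
      using smultC_of_nat[of 4 "x * y"] by (simp add: power2_eq_square algebra_simps)
    then have "4 * p (x * y) = p ((x + y)^2 - (x - y)^2)"
      using seminorm_smultC[OF S p, of "x * y" 4] cl xy by simp
    also have "\<dots> \<le> p (x + y)^2 + p (x - y)^2"
      using seminorm_diff[OF S p, of "(x + y)^2" "(x - y)^2"] u cl xy
      by (simp add: uniform_on_def)
    also have "\<dots> \<le> 2^2 + 2^2"
      using that seminorm_add[OF S p, of x y] seminorm_diff[OF S p, of x y]
        seminorm_nonneg[OF S p, of "x + y"] seminorm_nonneg[OF S p, of "x - y"] cl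
      by (intro add_mono power_mono) auto
    finally show ?thesis by simp
  qed
  have two': "p (x * y) \<le> 2 * (s * t)" if xy: "x \<in> S" "y \<in> S" and st: "p x < s" "p y < t" for x y s t
  proof -
    have pos: "0 < s" "0 < t" using seminorm_nonneg[OF S p] xy st by force+
    have "smultC (1 / s) x * smultC (1 / t) y = smultC (1 / (s * t)) (x * y)"
      by (simp add: smultC_conv_mult[of _ x] smultC_conv_mult[of _ y] smultC_conv_mult[of _ "x * y"]
          smultC_one_mult[symmetric] algebra_simps)
    then have "p (x * y) / (s * t) = p (smultC (1 / s) x * smultC (1 / t) y)"
      using seminorm_smultC[OF S p, of "x * y" "1 / (s * t)"] xy cl pos
      by (simp add: norm_divide norm_mult)
    also have "\<dots> \<le> 2"
      using xy cl pos st by (intro two) (auto simp: seminorm_smultC[OF S p] norm_divide)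
    finally show ?thesis using pos by (simp add: field_simps)
  qed
  fix x y assume xy: "x \<in> S" "y \<in> S"
  show "p (x * y) \<le> p x * p y"
  proof (rule le_mult_by_approx)
    fix s t assume st: "p x < s" "p y < t"
    have pos: "0 < s" "0 < t" using seminorm_nonneg[OF S p] xy st by force+
    have "p (x * y) / (s * t) \<le> 1"
    proof (rule power2n_bounded_imp_le_one)
      fix n
      have "p (x * y) ^ (2 ^ n) = p (x ^ 2 ^ n * y ^ 2 ^ n)"
        using uniform_power2n[OF S u, of "x * y"] xy cl by (simp add: power_mult_distrib)
      also have "\<dots> \<le> 2 * (s ^ 2 ^ n * t ^ 2 ^ n)"
        using xy cl st seminorm_nonneg[OF S p]
        by (intro two') (auto simp: uniform_power2n[OF S u] intro!: power_strict_mono)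
      finally show "(p (x * y) / (s * t)) ^ 2 ^ n \<le> 2"
        using pos by (simp add: power_divide power_mult_distrib field_simps)
    qed
    then show "p (x * y) \<le> s * t" using pos by simp
  qed
qed

text \<open>The square law settles only exponents of the form \<open>2 ^ n\<close>. For the others,
  \<open>x ^ (2 ^ n)\<close> is split as \<open>x ^ n * x ^ (2 ^ n - n)\<close> and the surplus
  power is cancelled, using \<open>0 < p x\<close>.\<close>

lemma uniform_power:
  fixes S :: "'a::calg set"
  assumes S: "subalgebra S" and p: "seminorm_on S p" and u: "uniform_on S p"
    and x: "x \<in> S" "0 < p x"
  shows "p (x ^ n) = p x ^ n"
proof (rule antisym)
  note cl = subalgebra_closed[OF S] and sm = uniform_imp_submultiplicative[OF S p u]
  have "p 1 ^ 2 = p 1" using u cl by (simp add: uniform_on_def) (metis one_power2)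
  then have one: "p 1 \<le> 1" by (auto simp: power2_eq_square)
  show "p (x ^ n) \<le> p x ^ n"
    using submult_power_le[OF S p sm x(1), of n] mult_right_mono[OF one, of "p x ^ n"] x
    by (simp add: order_trans)
  \<comment> \<open>Strictness keeps the exponent \<open>2 ^ n - n\<close> positive, as
    \<open>submult_power_le'\<close> requires.\<close>
  have n: "n < 2 ^ n" by simp
  have "p x ^ n * p x ^ (2 ^ n - n) = p (x ^ n * x ^ (2 ^ n - n))"
    using uniform_power2n[OF S u x(1), of n] n by (simp flip: power_add)
  also have "\<dots> \<le> p (x ^ n) * p (x ^ (2 ^ n - n))"
    using sm x cl by (simp add: submultiplicative_on_def)
  also have "\<dots> \<le> p (x ^ n) * p x ^ (2 ^ n - n)"
    using submult_power_le'[OF S p sm x(1), of "2 ^ n - n"] n x cl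
    by (intro mult_left_mono seminorm_nonneg[OF S p]) auto
  finally show "p x ^ n \<le> p (x ^ n)" using x by simp
qed

section \<open>Multiplicative seminorms below a uniform seminorm\<close>

text \<open>Compares the growth of \<open>a * y ^ n\<close> with that of \<open>y ^ n\<close>. The
  quotients decrease in \<open>n\<close>, so \<open>lim\<close> is a genuine limit for
  \<open>a\<close> in \<open>S\<close>.\<close>

definition orbit_seminorm :: "('a::calg \<Rightarrow> real) \<Rightarrow> 'a \<Rightarrow> 'a \<Rightarrow> real" where
  "orbit_seminorm p y a = lim (\<lambda>n. p (a * y ^ n) / p y ^ n)"

context
  fixes S :: "'a::calg set" and p y
  assumes S: "subalgebra S" and p: "seminorm_on S p" and u: "uniform_on S p"
    and y: "y \<in> S" "0 < p y"
begin

lemma orbit_submult: "a \<in> S \<Longrightarrow> b \<in> S \<Longrightarrow> p (a * b) \<le> p a * p b"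
  using uniform_imp_submultiplicative[OF S p u] by (simp add: submultiplicative_on_def)

lemma orbit_decseq:
  assumes "a \<in> S"
  shows "decseq (\<lambda>n. p (a * y ^ n) / p y ^ n)"
proof (rule decseq_SucI)
  fix n
  have "p (a * y ^ n * y) \<le> p (a * y ^ n) * p y"
    using assms y subalgebra_closed[OF S] by (intro orbit_submult) auto
  then show "p (a * y ^ Suc n) / p y ^ Suc n \<le> p (a * y ^ n) / p y ^ n"
    using y by (simp add: divide_simps mult_ac)
qed

lemma orbit_nonneg: "a \<in> S \<Longrightarrow> 0 \<le> p (a * y ^ n) / p y ^ n"
  using y subalgebra_closed[OF S] seminorm_nonneg[OF S p] by simp

lemma orbit_tendsto:
  assumes "a \<in> S"
  shows "(\<lambda>n. p (a * y ^ n) / p y ^ n) \<longlonglongrightarrow> orbit_seminorm p y a"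
  unfolding orbit_seminorm_def
  using decseq_convergent[OF orbit_decseq[OF assms], of 0] orbit_nonneg[OF assms]
  by (metis convergentI convergent_LIMSEQ_iff)

lemma orbit_eqI: "(\<lambda>n. p (a * y ^ n) / p y ^ n) \<longlonglongrightarrow> L \<Longrightarrow> orbit_seminorm p y a = L"
  by (simp add: orbit_seminorm_def limI)

lemma orbit_le: "a \<in> S \<Longrightarrow> orbit_seminorm p y a \<le> p a"
  using decseq_ge[OF orbit_decseq orbit_tendsto, of a 0] by simp

lemma orbit_seminorm: "seminorm_on S (orbit_seminorm p y)"
  unfolding seminorm_on_def
proof (intro conjI ballI allI)
  note cl = subalgebra_closed[OF S]
  fix a b c assume a: "a \<in> S"
  show "0 \<le> orbit_seminorm p y a"
    using LIMSEQ_le_const[OF orbit_tendsto[OF a]] orbit_nonneg[OF a] by blast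
  have eq: "p (smultC c a * y ^ n) / p y ^ n = cmod c * (p (a * y ^ n) / p y ^ n)" for n
    using seminorm_smultC[OF S p, of "a * y ^ n" c] a y cl by (simp add: smultC_mult_left)
  show "orbit_seminorm p y (smultC c a) = cmod c * orbit_seminorm p y a"
    by (rule orbit_eqI, unfold eq) (rule tendsto_mult_left[OF orbit_tendsto[OF a]])
  assume b: "b \<in> S"
  have "p ((a + b) * y ^ n) / p y ^ n \<le> p (a * y ^ n) / p y ^ n + p (b * y ^ n) / p y ^ n" for n
    using seminorm_add[OF S p, of "a * y ^ n" "b * y ^ n"] a b y cl
    by (simp add: distrib_right divide_right_mono flip: add_divide_distrib)
  then show "orbit_seminorm p y (a + b) \<le> orbit_seminorm p y a + orbit_seminorm p y b"
    using LIMSEQ_le[OF orbit_tendsto[of "a + b"] tendsto_add[OF orbit_tendsto[OF a] orbit_tendsto[OF b]]]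
      a b cl by blast
qed

text \<open>The square of the \<open>n\<close>-th quotient for \<open>a\<close> is the quotient of
  index \<open>2 * n\<close> for \<open>a^2\<close>, so both sides are limits of the same
  sequence.\<close>

lemma orbit_uniform: "uniform_on S (orbit_seminorm p y)"
  unfolding uniform_on_def
proof
  note cl = subalgebra_closed[OF S]
  fix a assume a: "a \<in> S"
  have "p (a^2 * y ^ (2 * n)) / p y ^ (2 * n) = (p (a * y ^ n) / p y ^ n)^2" for n
  proof -
    have "p ((a * y ^ n)^2) = p (a * y ^ n)^2" using u a y cl by (simp add: uniform_on_def)
    then show ?thesis by (simp add: power_mult_distrib power_divide power_mult[symmetric] mult.commute)
  qed
  moreover have "(\<lambda>n. p (a^2 * y ^ (2 * n)) / p y ^ (2 * n)) \<longlonglongrightarrow> orbit_seminorm p y (a^2)"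
    using LIMSEQ_subseq_LIMSEQ[OF orbit_tendsto[of "a^2"], of "\<lambda>n. 2 * n"] a cl
    by (simp add: o_def strict_mono_def)
  ultimately show "orbit_seminorm p y (a^2) = orbit_seminorm p y a ^ 2"
    using LIMSEQ_unique[OF _ tendsto_power[OF orbit_tendsto[OF a], of 2]] by simp
qed

lemma orbit_one: "orbit_seminorm p y 1 = 1"
  using uniform_power[OF S p u y] y by (simp add: orbit_seminorm_def)

text \<open>A factorisation in one direction \<open>x\<close> survives the passage to the orbit
  along another direction \<open>y\<close>. This keeps the Zorn family below stable.\<close>

lemma orbit_mult_generic:
  assumes x: "x \<in> S" and m: "\<And>a. a \<in> S \<Longrightarrow> p (a * x) = p a * c" and a: "a \<in> S"
  shows "orbit_seminorm p y (a * x) = orbit_seminorm p y a * c"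
proof -
  have eq: "p (a * x * y ^ n) / p y ^ n = p (a * y ^ n) / p y ^ n * c" for n
    using m[of "a * y ^ n"] subalgebra_closed[OF S] a y by (simp add: mult_ac)
  show ?thesis
    by (rule orbit_eqI, unfold eq) (rule tendsto_mult_right[OF orbit_tendsto[OF a]])
qed

text \<open>Multiplying by \<open>y\<close> only shifts the sequence by one index, at the cost of
  the factor \<open>p y\<close>.\<close>

lemma orbit_mult:
  assumes a: "a \<in> S"
  shows "orbit_seminorm p y (a * y) = orbit_seminorm p y a * p y"
proof -
  have eq: "p (a * y * y ^ n) / p y ^ n = p (a * y ^ Suc n) / p y ^ Suc n * p y" for n
    using y by (simp add: mult_ac)
  show ?thesis
    by (rule orbit_eqI, unfold eq) (rule tendsto_mult_right[OF LIMSEQ_Suc[OF orbit_tendsto[OF a]]])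
qed

end

text \<open>A pointwise infimum of seminorms need not be subadditive. In a chain, the smaller
  \<open>s\<close> of \<open>q\<close> and \<open>r\<close> satisfies
  \<open>s a + s b \<le> q a + r b\<close>, so the two infima can be taken separately.\<close>

lemma chain_Inf_seminorm:
  fixes S :: "'a::calg set" and C :: "('a \<Rightarrow> real) set"
  assumes S: "subalgebra S" and ne: "C \<noteq> {}"
    and chain: "\<And>q r. q \<in> C \<Longrightarrow> r \<in> C \<Longrightarrow> q \<le> r \<or> r \<le> q"
    and sn: "\<And>q. q \<in> C \<Longrightarrow> seminorm_on S q" and u: "\<And>q. q \<in> C \<Longrightarrow> uniform_on S q"
  defines "m \<equiv> \<lambda>a. INF q\<in>C. q a"
  shows "seminorm_on S m" "uniform_on S m"
proof -
  note cl = subalgebra_closed[OF S]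
  have bdd: "bdd_below ((\<lambda>q. q a) ` C)" if "a \<in> S" for a
    using seminorm_nonneg[OF S sn] that by (intro bdd_belowI[of _ 0]) auto
  have le: "m a \<le> q a" if "q \<in> C" "a \<in> S" for q a
    unfolding m_def using bdd that by (intro cINF_lower) auto
  have ge: "c \<le> m a" if "\<And>q. q \<in> C \<Longrightarrow> c \<le> q a" for c a
    unfolding m_def using ne that by (intro cINF_greatest) auto
  have nonneg: "0 \<le> m a" if "a \<in> S" for a
    using seminorm_nonneg[OF S sn] that by (intro ge) auto
  show "seminorm_on S m"
  proof (rule seminorm_onI[OF S])
    fix a b c assume a: "a \<in> S"
    show "0 \<le> m a" by (fact nonneg[OF a])
    show "m (smultC c a) \<le> cmod c * m a"
    proof (cases "c = 0")
      case True
      obtain q where "q \<in> C" using ne by blast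
      then show ?thesis using le[of q 0] seminorm_zero[OF S sn, of q] True cl by simp
    next
      case False
      have "m (smultC c a) / cmod c \<le> m a"
      proof (rule ge)
        fix q assume "q \<in> C"
        then show "m (smultC c a) / cmod c \<le> q a"
          using le[of q "smultC c a"] seminorm_smultC[OF S sn, of q a c] False a cl
          by (simp add: divide_simps mult.commute)
      qed
      then show ?thesis using False by (simp add: field_simps)
    qed
    assume b: "b \<in> S"
    have sum: "m (a + b) \<le> q a + r b" if "q \<in> C" "r \<in> C" for q r
    proof -
      obtain s where s: "s \<in> C" "s \<le> q" "s \<le> r" using chain[of q r] \<open>q \<in> C\<close> \<open>r \<in> C\<close> by blast
      then have "m (a + b) \<le> s a + s b"
        using le[of s "a + b"] seminorm_add[OF S sn, of s a b] a b cl by fastforce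
      then show ?thesis using s le_funD[of s q a] le_funD[of s r b] by simp
    qed
    have "m (a + b) - q a \<le> m b" if "q \<in> C" for q
    proof (rule ge)
      fix r assume "r \<in> C"
      with that show "m (a + b) - q a \<le> r b" using sum[of q r] by simp
    qed
    then have "m (a + b) - m b \<le> m a"
      by (intro ge) (simp add: algebra_simps)
    then show "m (a + b) \<le> m a + m b" by simp
  qed
  show "uniform_on S m"
    unfolding uniform_on_def
  proof (intro ballI antisym)
    fix a assume a: "a \<in> S"
    have "sqrt (m (a^2)) \<le> m a"
    proof (rule ge)
      fix q assume q: "q \<in> C"
      have "m (a^2) \<le> q a ^ 2" using le[OF q, of "a^2"] u[OF q] a cl by (simp add: uniform_on_def)
      then show "sqrt (m (a^2)) \<le> q a" using seminorm_nonneg[OF S sn[OF q] a] by (simp add: real_le_lsqrt)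
    qed
    then show "m (a^2) \<le> m a ^ 2" using sqrt_le_D by blast
    show "m a ^ 2 \<le> m (a^2)"
    proof (rule ge)
      fix q assume q: "q \<in> C"
      show "m a ^ 2 \<le> q (a^2)" using le[OF q a] u[OF q] a nonneg[OF a] by (simp add: uniform_on_def power_mono)
    qed
  qed
qed

lemma uniform_dominates_multiplicative:
  fixes S :: "'a::calg set"
  assumes S: "subalgebra S" and p: "seminorm_on S p" and u: "uniform_on S p"
    and x: "x \<in> S" "0 < p x"
  obtains q where "seminorm_on S q" "\<And>a b. a \<in> S \<Longrightarrow> b \<in> S \<Longrightarrow> q (a * b) = q a * q b"
    "q 1 = 1" "\<And>a. a \<in> S \<Longrightarrow> q a \<le> p a" "q x = p x"
proof -
  note cl = subalgebra_closed[OF S]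
  \<comment> \<open>Keeping the factorisation \<open>q (a * x) = q a * p x\<close> in the Zorn family, rather than just \<open>q x = p x\<close>,
    makes the family stable under \<open>q \<mapsto> orbit_seminorm q y\<close>, which forces a minimal \<open>q\<close> to be
    multiplicative.\<close>
  define good where "good q \<longleftrightarrow> seminorm_on S q \<and> uniform_on S q \<and> q 1 = 1
      \<and> (\<forall>a\<in>S. q (a * x) = q a * p x) \<and> (\<forall>a\<in>S. q a \<le> p a)" for q
  \<comment> \<open>Values outside \<open>S\<close> are arbitrary; setting them to 0 lets minimality
    be expressed by equality of functions.\<close>
  define cut where "cut q = (\<lambda>a. if a \<in> S then q a else 0)" for q :: "'a \<Rightarrow> real"
  define Z where "Z = {q. good q \<and> (\<forall>a. a \<notin> S \<longrightarrow> q a = 0)}"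
  have good_cong: "good q" if "good r" "\<And>a. a \<in> S \<Longrightarrow> q a = r a" for q r
    using that x unfolding good_def seminorm_on_def uniform_on_def by (simp add: cl)
  have cutZ: "cut q \<in> Z" if "good q" for q
    using good_cong[OF that, of "cut q"] by (simp add: Z_def cut_def)
  \<comment> \<open>The orbit along \<open>x\<close> supplies the factorisation through
    \<open>x\<close>, which \<open>p\<close> itself may lack. It also serves as the bound of the
    empty chain.\<close>
  have start: "cut (orbit_seminorm p x) \<in> Z"
    using orbit_seminorm[OF S p u x] orbit_uniform[OF S p u x] orbit_one[OF S p u x]
      orbit_mult[OF S p u x] orbit_le[OF S p u x] by (intro cutZ) (simp add: good_def)
  \<comment> \<open>The order is reversed because \<open>predicate_Zorn\<close> yields maximal
    elements.\<close>
  define R where "R = (\<lambda>(q::'a \<Rightarrow> real) r. r \<le> q)"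
  have "\<exists>m\<in>Z. \<forall>a\<in>Z. R m a \<longrightarrow> a = m"
  proof (rule predicate_Zorn)
    show "partial_order_on Z (relation_of R Z)"
      unfolding R_def by (intro partial_order_on_relation_ofI) auto
    fix C assume C: "C \<in> Chains (relation_of R Z)"
    then have CZ: "q \<in> Z" if "q \<in> C" for q
      using that Chains_relation_of by blast
    show "\<exists>r\<in>Z. \<forall>q\<in>C. R q r"
    proof (cases "C = {}")
      case True then show ?thesis using start by auto
    next
      case ne: False
      have chain: "q \<le> r \<or> r \<le> q" if "q \<in> C" "r \<in> C" for q r
        using C that unfolding Chains_def relation_of_def R_def by auto
      have good: "good q" if "q \<in> C" for q using CZ[OF that] by (simp add: Z_def)
      define m where "m = (\<lambda>a. INF q\<in>C. q a)"
      have bdd: "bdd_below ((\<lambda>q. q a) ` C)" for a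
      proof (intro bdd_belowI[of _ 0])
        fix v assume "v \<in> (\<lambda>q. q a) ` C"
        then obtain q where "q \<in> C" "v = q a" by blast
        then show "0 \<le> v"
          using CZ[of q] seminorm_nonneg[OF S, of q a] by (cases "a \<in> S") (auto simp: good_def Z_def)
      qed
      have le: "m \<le> q" if "q \<in> C" for q
        unfolding m_def using bdd that by (intro le_funI cINF_lower) auto
      obtain q0 where q0: "q0 \<in> C" using ne by blast
      have "good m"
        unfolding good_def
      proof (intro conjI ballI)
        show "seminorm_on S m" "uniform_on S m"
          unfolding m_def using chain_Inf_seminorm[OF S ne chain] good by (auto simp: good_def)
        have "m 1 = (INF q\<in>C. 1)" unfolding m_def using good by (intro INF_cong) (auto simp: good_def)
        then show "m 1 = 1" using ne by simp
        fix a assume a: "a \<in> S"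
        have "m (a * x) = (INF q\<in>C. q a * p x)"
          unfolding m_def using good a by (intro INF_cong) (auto simp: good_def)
        also have "\<dots> = m a * p x"
        proof (rule antisym)
          have bdd': "bdd_below ((\<lambda>q. q a * p x) ` C)"
          proof (intro bdd_belowI[of _ 0])
            fix v assume "v \<in> (\<lambda>q. q a * p x) ` C"
            then obtain q where "q \<in> C" and v: "v = q a * p x" by blast
            then have "0 \<le> q a" using good[of q] seminorm_nonneg[OF S _ a] by (simp add: good_def)
            then show "0 \<le> v" using v x by simp
          qed
          \<comment> \<open>Dividing by \<open>p x > 0\<close> pulls the constant factor out of the
            infimum.\<close>
          have "(INF q\<in>C. q a * p x) / p x \<le> m a"
            unfolding m_def using ne bdd' x
            by (intro cINF_greatest) (auto simp: divide_simps intro: cINF_lower)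
          then show "(INF q\<in>C. q a * p x) \<le> m a * p x" using x by (simp add: divide_simps)
          show "m a * p x \<le> (INF q\<in>C. q a * p x)"
            using ne le x by (intro cINF_greatest) (auto simp: le_fun_def)
        qed
        finally show "m (a * x) = m a * p x" .
        show "m a \<le> p a" using le_funD[OF le[OF q0], of a] good[OF q0] a by (auto simp: good_def)
      qed
      moreover have "m a = 0" if "a \<notin> S" for a
      proof -
        have "m a = (INF q\<in>C. 0)" unfolding m_def using CZ that by (intro INF_cong) (auto simp: Z_def)
        then show ?thesis using ne by simp
      qed
      ultimately have "m \<in> Z" by (simp add: Z_def)
      then show ?thesis using le by (auto simp: R_def)
    qed
  qed
  then obtain q where q: "q \<in> Z" and min: "\<And>r. r \<in> Z \<Longrightarrow> r \<le> q \<Longrightarrow> r = q" by (auto simp: R_def)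
  have qs: "seminorm_on S q" "uniform_on S q" "q 1 = 1" "\<And>a. a \<in> S \<Longrightarrow> q (a * x) = q a * p x"
    "\<And>a. a \<in> S \<Longrightarrow> q a \<le> p a" "\<And>a. a \<notin> S \<Longrightarrow> q a = 0"
    using q by (auto simp: Z_def good_def)
  have mult: "q (a * y) = q a * q y" if a: "a \<in> S" and y: "y \<in> S" for a y
  \<comment> \<open>The orbit along \<open>y\<close> divides by powers of \<open>q y\<close>, so the
    vanishing case is settled by submultiplicativity instead.\<close>
  proof (cases "q y = 0")
    case True
    then have "q (a * y) \<le> 0"
      using submultiplicative_on_def[of S q] uniform_imp_submultiplicative[OF S qs(1,2)] a y
      by (metis mult_zero_right)
    then show ?thesis using True seminorm_nonneg[OF S qs(1), of "a * y"] a y cl by simp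
  next
    case False
    then have pos: "0 < q y" using seminorm_nonneg[OF S qs(1) y] by simp
    note o = S qs(1,2) y pos
    have le: "orbit_seminorm q y a \<le> q a" if "a \<in> S" for a by (rule orbit_le[OF o that])
    have "good (orbit_seminorm q y)"
      unfolding good_def
      using orbit_seminorm[OF o] orbit_uniform[OF o] orbit_one[OF o]
        orbit_mult_generic[OF o x(1) qs(4)] le qs(5) by (fastforce intro: order_trans)
    \<comment> \<open>Minimality turns the domination by \<open>q\<close> into equality, so
      multiplicativity in the direction \<open>y\<close> passes from the orbit seminorm to
      \<open>q\<close>.\<close>
    then have eq: "cut (orbit_seminorm q y) = q"
      using le qs(6) by (intro min cutZ) (auto simp: cut_def le_fun_def)
    have "orbit_seminorm q y a = q a" if "a \<in> S" for a
      using fun_cong[OF eq, of a] that by (simp add: cut_def)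
    then show ?thesis using orbit_mult[OF o a] a y cl by simp
  qed
  show thesis
    using that[OF qs(1) mult qs(3) qs(5)] qs(3) qs(4)[of 1] cl by simp
qed

section \<open>Multiplicative seminorms are moduli of characters\<close>

context
  fixes S :: "'a::calg set" and q
  assumes S: "subalgebra S" and q: "seminorm_on S q"
    and mult: "\<And>a b. a \<in> S \<Longrightarrow> b \<in> S \<Longrightarrow> q (a * b) = q a * q b" and one: "q 1 = 1"
begin

lemma multiplicative_seminorm_smultC_one: "q (smultC c 1) = cmod c"
  using seminorm_smultC[OF S q, of 1 c] one subalgebra_closed[OF S] by simp

lemma multiplicative_seminorm_power: "a \<in> S \<Longrightarrow> q (a ^ n) = q a ^ n"
  by (induction n) (simp_all add: one mult subalgebra_closed[OF S])

text \<open>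
  Factoring \<open>y\<^sup>N - l\<^sup>N\<close> over \<open>N = 2\<^sup>n\<close> by repeated square roots, every factor other than \<open>y - l\<close> has
  seminorm at least \<open>m\<close>, so \<open>q (y - l) m\<^sup>N \<le> m (m\<^sup>N + \<bar>l\<bar>\<^sup>N)\<close>.
\<close>
lemma minimal_distance_ball:
  assumes y: "y \<in> S" and m: "0 < m" "q y = m" and min: "\<And>\<mu>. m \<le> q (y - smultC \<mu> 1)"
    and l: "cmod l < m"
  shows "q (y - smultC l 1) = m"
proof (rule antisym)
  note cl = subalgebra_closed[OF S]
  have factor: "y ^ 2 ^ Suc n - smultC (\<mu>^2) 1 = (y ^ 2 ^ n - smultC \<mu> 1) * (y ^ 2 ^ n - smultC (- \<mu>) 1)"
    for n \<mu>
  proof -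
    have "y ^ 2 ^ Suc n = (y ^ 2 ^ n)^2" by (simp add: power_mult[symmetric] mult.commute)
    then show ?thesis
      by (simp add: power2_eq_square smultC_one_mult smultC_minus_left algebra_simps)
  qed
  \<comment> \<open>Every \<open>\<mu>\<close> has a complex square root, so a difference at level
    \<open>Suc n\<close> splits into two at level \<open>n\<close>; hence the induction is over all
    \<open>\<mu>\<close> at once.\<close>
  have lower: "m ^ 2 ^ n \<le> q (y ^ 2 ^ n - smultC \<mu> 1)" for n \<mu>
  proof (induction n arbitrary: \<mu>)
    case 0 then show ?case using min by simp
  next
    case (Suc n)
    have "m ^ 2 ^ n * m ^ 2 ^ n \<le> q (y ^ 2 ^ n - smultC (csqrt \<mu>) 1) * q (y ^ 2 ^ n - smultC (- csqrt \<mu>) 1)"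
      using Suc m y by (intro mult_mono seminorm_nonneg[OF S q] cl) auto
    also have "\<dots> = q (y ^ 2 ^ Suc n - smultC \<mu> 1)"
      using factor[of n "csqrt \<mu>"] y by (simp add: mult cl)
    finally show ?case by (simp add: power_add[symmetric] mult_2)
  qed
  \<comment> \<open>At each level the companion factor, with \<open>+\<close> in place of
    \<open>-\<close>, is bounded below by \<open>lower\<close>.\<close>
  have upper: "q (y - smultC l 1) * m ^ 2 ^ n \<le> m * q (y ^ 2 ^ n - smultC (l ^ 2 ^ n) 1)" for n
  proof (induction n)
    case 0 then show ?case by simp
  next
    case (Suc n)
    let ?r = "q (y ^ 2 ^ n - smultC (l ^ 2 ^ n) 1)" and ?s = "q (y ^ 2 ^ n - smultC (- (l ^ 2 ^ n)) 1)"
    have "q (y - smultC l 1) * m ^ 2 ^ n * m ^ 2 ^ n \<le> m * ?r * ?s"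
      using m(1) y by (intro mult_mono[OF Suc lower] mult_nonneg_nonneg seminorm_nonneg[OF S q] cl) auto
    moreover have "?r * ?s = q (y ^ 2 ^ Suc n - smultC ((l ^ 2 ^ n)^2) 1)"
      unfolding factor using y by (simp add: mult cl)
    moreover have "(l ^ 2 ^ n)^2 = l ^ 2 ^ Suc n" by (simp add: power_mult[symmetric] mult.commute)
    ultimately show ?case by (simp add: power_add mult_2 mult.assoc)
  qed
  have "q (y - smultC l 1) \<le> m * (1 + (cmod l / m) ^ 2 ^ n)" for n
  proof -
    have "q (y - smultC l 1) * m ^ 2 ^ n \<le> m * (m ^ 2 ^ n + cmod l ^ 2 ^ n)"
    proof (rule order_trans[OF upper mult_left_mono])
      show "q (y ^ 2 ^ n - smultC (l ^ 2 ^ n) 1) \<le> m ^ 2 ^ n + cmod l ^ 2 ^ n"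
        using seminorm_diff[OF S q, of "y ^ 2 ^ n" "smultC (l ^ 2 ^ n) 1"] m y
        by (simp add: cl multiplicative_seminorm_smultC_one multiplicative_seminorm_power norm_power)
    qed (use m in simp)
    also have "\<dots> = m * (1 + (cmod l / m) ^ 2 ^ n) * m ^ 2 ^ n"
      using m by (simp add: power_divide field_simps)
    finally show ?thesis using m by simp
  qed
  moreover have "(\<lambda>n. m * (1 + (cmod l / m) ^ 2 ^ n)) \<longlonglongrightarrow> m * (1 + 0)"
  proof (intro tendsto_intros)
    have "strict_mono (\<lambda>n::nat. 2 ^ n :: nat)" by (simp add: strict_mono_def)
    then show "(\<lambda>n. (cmod l / m) ^ 2 ^ n) \<longlonglongrightarrow> 0"
      using LIMSEQ_subseq_LIMSEQ[OF LIMSEQ_power_zero[of "cmod l / m"]] m l by (simp add: o_def)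
  qed
  ultimately show "q (y - smultC l 1) \<le> m"
    using LIMSEQ_le_const[of _ "m * (1 + 0)" "q (y - smultC l 1)"] by auto
qed (rule min)

text \<open>The distance from \<open>x\<close> to the scalars attains a minimum. If it were
  positive, the scalars attaining it would form an open set by \<open>minimal_distance_ball\<close>
  and a closed set by continuity, hence the whole plane; but the distance grows without
  bound.\<close>

lemma exists_scalar_in_kernel:
  assumes x: "x \<in> S"
  shows "\<exists>l. q (x - smultC l 1) = 0"
proof -
  note cl = subalgebra_closed[OF S]
  define \<phi> where "\<phi> l = q (x - smultC l 1)" for l
  have lip: "\<bar>\<phi> k - \<phi> l\<bar> \<le> dist k l" for k l
  proof -
    have "\<phi> k - \<phi> l \<le> cmod (k - l)" for k l
      using seminorm_diff_ge[OF S q, of "x - smultC k 1" "x - smultC l 1"] x cl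
        multiplicative_seminorm_smultC_one[of "l - k"]
      by (simp add: \<phi>_def smultC_diff_left norm_minus_commute)
    from this[of k l] this[of l k] show ?thesis by (simp add: dist_norm norm_minus_commute abs_le_iff)
  qed
  have cont: "continuous_on A \<phi>" for A
    unfolding continuous_on_iff
    by (metis lip dist_real_def dist_commute order_le_less_trans)
  have far: "cmod l - q x \<le> \<phi> l" for l
    using seminorm_diff_ge[OF S q, of "smultC l 1" x] multiplicative_seminorm_smultC_one[of l] x cl
      seminorm_minus_commute[OF S q, of x "smultC l 1"] by (simp add: \<phi>_def)
  have phi0: "\<phi> 0 = q x" by (simp add: \<phi>_def)
  have qx: "0 \<le> q x" using seminorm_nonneg[OF S q x] .
  \<comment> \<open>Outside the disc of radius \<open>2 * q x\<close> the value of
    \<open>\<phi>\<close> is at least \<open>q x = \<phi> 0\<close>, so the minimum over the disc is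
    global.\<close>
  obtain l0 where l0: "l0 \<in> cball 0 (2 * q x)" and inf: "\<And>l. l \<in> cball 0 (2 * q x) \<Longrightarrow> \<phi> l0 \<le> \<phi> l"
    using continuous_attains_inf[OF compact_cball _ cont, of 0 "2 * q x"] qx by auto
  have min: "\<phi> l0 \<le> \<phi> l" for l
  proof (cases "cmod l \<le> 2 * q x")
    case False
    then have "\<phi> 0 \<le> \<phi> l" using far[of l] phi0 by linarith
    moreover have "\<phi> l0 \<le> \<phi> 0" using qx by (intro inf) simp
    ultimately show ?thesis by linarith
  qed (simp add: inf)
  have "\<phi> l0 = 0"
  proof (rule ccontr)
    assume "\<phi> l0 \<noteq> 0"
    then have pos: "0 < \<phi> l0" using seminorm_nonneg[OF S q, of "x - smultC l0 1"] x cl by (simp add: \<phi>_def)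
    define L where "L = {l. \<phi> l = \<phi> l0}"
    have "closed L" unfolding L_def using closed_Collect_eq[OF cont continuous_on_const] by simp
    moreover have "open L"
      unfolding open_contains_ball
    proof
      fix l assume l: "l \<in> L"
      \<comment> \<open>The previous lemma is applied to the translate \<open>x - l\<close>, whose
        distance to the scalars is still \<open>\<phi> l0\<close>.\<close>
      have "ball l (\<phi> l0) \<subseteq> L"
      proof
        fix k assume k: "k \<in> ball l (\<phi> l0)"
        have eq: "x - smultC l 1 - smultC \<mu> 1 = x - smultC (l + \<mu>) 1" for \<mu>
          by (simp add: smultC_add_left)
        have "q (x - smultC l 1 - smultC (k - l) 1) = \<phi> l0"
        proof (rule minimal_distance_ball)
          show "\<phi> l0 \<le> q (x - smultC l 1 - smultC \<mu> 1)" for \<mu>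
            using min[of "l + \<mu>"] by (simp add: eq \<phi>_def)
        qed (use l x cl k pos in \<open>auto simp: L_def \<phi>_def dist_norm norm_minus_commute\<close>)
        then show "k \<in> L" by (simp add: L_def \<phi>_def eq)
      qed
      then show "\<exists>e>0. ball l e \<subseteq> L" using pos by blast
    qed
    ultimately have "L = UNIV" using clopen[of L] by (auto simp: L_def)
    \<comment> \<open>At this scalar \<open>far\<close> gives a value of at least
      \<open>q x + \<phi> l0 + 1\<close>, more than the minimum.\<close>
    then have "\<phi> (of_real (2 * q x + \<phi> l0 + 1)) = \<phi> l0" by (auto simp: L_def)
    then show False using far[of "of_real (2 * q x + \<phi> l0 + 1)"] qx pos
      by (simp del: of_real_add of_real_mult of_real_numeral)
  qed
  then show ?thesis by (auto simp: \<phi>_def)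
qed

text \<open>The character sends \<open>x\<close> to the scalar at \<open>q\<close>-distance 0 from
  it, which is unique because \<open>q\<close> is the modulus on scalars. The algebraic identities
  hold because the elements with \<open>q = 0\<close> form an ideal.\<close>

lemma multiplicative_seminorm_character:
  obtains f where "f \<in> Mstar S" "\<And>a. a \<in> S \<Longrightarrow> cmod (f a) = q a"
proof -
  note cl = subalgebra_closed[OF S]
  define f where "f x = (SOME l. q (x - smultC l 1) = 0)" for x
  have f: "q (x - smultC (f x) 1) = 0" if "x \<in> S" for x
    unfolding f_def using someI_ex[OF exists_scalar_in_kernel[OF that]] .
  have unique: "f x = l" if x: "x \<in> S" and "q (x - smultC l 1) \<le> 0" for x l
  proof -
    have "q (x - smultC l 1 - (x - smultC (f x) 1)) \<le> 0"
      using seminorm_diff[OF S q, of "x - smultC l 1" "x - smultC (f x) 1"] f[OF x] that cl by simp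
    then show ?thesis using multiplicative_seminorm_smultC_one[of "f x - l"] by (simp add: smultC_diff_left)
  qed
  have norm: "cmod (f a) = q a" if a: "a \<in> S" for a
    using seminorm_diff_ge[OF S q, of a "smultC (f a) 1"] seminorm_diff_ge[OF S q, of "smultC (f a) 1" a]
      seminorm_minus_commute[OF S q, of a "smultC (f a) 1"] f[OF a] a cl multiplicative_seminorm_smultC_one[of "f a"]
    by simp
  have "f \<in> Mstar S"
    unfolding Mstar_def
  proof (intro CollectI conjI ballI allI)
    fix x y c assume x: "x \<in> S"
    show "f (smultC c x) = c * f x"
    proof (rule unique)
      have "smultC c x - smultC (c * f x) 1 = smultC c 1 * (x - smultC (f x) 1)"
        by (simp add: smultC_one_mult algebra_simps smultC_conv_mult[of c x])
      then show "q (smultC c x - smultC (c * f x) 1) \<le> 0"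
        using f[OF x] x cl by (simp add: mult)
    qed (use x cl in auto)
    assume y: "y \<in> S"
    have xy: "x - smultC (f x) 1 \<in> S" "y - smultC (f y) 1 \<in> S" using x y cl by auto
    show "f (x + y) = f x + f y"
      using seminorm_add[OF S q xy] f[OF x] f[OF y] x y cl
      by (intro unique) (auto simp: smultC_add_left algebra_simps)
    show "f (x * y) = f x * f y"
    proof (rule unique)
      have "x * y - smultC (f x * f y) 1 = (x - smultC (f x) 1) * y + smultC (f x) 1 * (y - smultC (f y) 1)"
        by (simp add: smultC_one_mult algebra_simps)
      then show "q (x * y - smultC (f x * f y) 1) \<le> 0"
        using seminorm_add[OF S q, of "(x - smultC (f x) 1) * y" "smultC (f x) 1 * (y - smultC (f y) 1)"]
          f[OF x] f[OF y] x y xy cl by (simp add: mult)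
    qed (use x y cl in auto)
  next
    have "f 1 \<noteq> 0" using norm[of 1] one cl by auto
    then show "\<exists>x\<in>S. f x \<noteq> 0" using cl by blast
  qed
  then show thesis using that norm by blast
qed

end

text \<open>Used twice: for the defining seminorms of \<open>A\<close>, and for the spectral
  seminorm of a quotient of the Q-algebra.\<close>

lemma uniform_seminorm_character:
  fixes S :: "'a::calg set"
  assumes S: "subalgebra S" and p: "seminorm_on S p" and u: "uniform_on S p"
    and x: "x \<in> S" "0 < p x"
  obtains f where "f \<in> Mstar S" "\<And>a. a \<in> S \<Longrightarrow> cmod (f a) \<le> p a" "cmod (f x) = p x"
proof -
  obtain q where q: "seminorm_on S q" "\<And>a b. a \<in> S \<Longrightarrow> b \<in> S \<Longrightarrow> q (a * b) = q a * q b"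
    "q 1 = 1" "\<And>a. a \<in> S \<Longrightarrow> q a \<le> p a" "q x = p x"
    using uniform_dominates_multiplicative[OF S p u x] by metis
  obtain f where "f \<in> Mstar S" "\<And>a. a \<in> S \<Longrightarrow> cmod (f a) = q a"
    using multiplicative_seminorm_character[OF S q(1-3)] by metis
  then show thesis using that q x by simp
qed

section \<open>Characters of Q-algebras\<close>

lemma le_add_by_approx:
  fixes r s t :: real
  assumes "\<And>s' t'. s < s' \<Longrightarrow> t < t' \<Longrightarrow> r \<le> s' + t'"
  shows "r \<le> s + t"
proof (rule field_le_epsilon)
  fix e :: real assume "0 < e"
  then show "r \<le> s + t + e" using assms[of "s + e / 2" "t + e / 2"] by simp
qed

lemma subalgebra_sum: "subalgebra S \<Longrightarrow> (\<And>i. i \<in> A \<Longrightarrow> h i \<in> S) \<Longrightarrow> sum h A \<in> S"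
  by (induction A rule: infinite_finite_induct) (auto intro: subalgebra_zero subalgebra_add)

lemma seminorm_sum:
  assumes S: "subalgebra S" and p: "seminorm_on S p" and "\<And>i. i \<in> A \<Longrightarrow> h i \<in> S"
  shows "p (sum h A) \<le> (\<Sum>i\<in>A. p (h i))"
  using assms(3)
proof (induction A rule: infinite_finite_induct)
  case (insert i A)
  then show ?case
    using seminorm_add[OF S p, of "h i" "sum h A"] subalgebra_sum[OF S, of A h] by force
qed (use seminorm_zero[OF S p] in auto)

section \<open>The spectral seminorm\<close>

definition power_bounded :: "('a::calg \<Rightarrow> real) \<Rightarrow> 'a \<Rightarrow> real \<Rightarrow> bool" where
  "power_bounded P a s \<longleftrightarrow> 0 < s \<and> (\<exists>K. \<forall>k. P (a ^ k) \<le> K * s ^ k)"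

text \<open>This is the spectral radius \<open>lim P (a ^ n) ^ (1/n)\<close>, written as an infimum
  of geometric growth rates so that its properties follow from bounds on powers.\<close>

definition spectral_seminorm :: "('a::calg \<Rightarrow> real) \<Rightarrow> 'a \<Rightarrow> real" where
  "spectral_seminorm P a = Inf {s. power_bounded P a s}"

context
  fixes S :: "'a::calg set" and P
  assumes S: "subalgebra S" and P: "seminorm_on S P" and sm: "submultiplicative_on S P"
begin

lemma power_bounded_mono:
  assumes "a \<in> S" "power_bounded P a s" "s \<le> t"
  shows "power_bounded P a t"
proof -
  obtain K where K: "\<And>k. P (a ^ k) \<le> K * s ^ k" and s: "0 < s"
    using assms by (auto simp: power_bounded_def)
  have "0 \<le> K" using K[of 0] seminorm_nonneg[OF S P, of 1] subalgebra_one[OF S] by simp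
  then have "P (a ^ k) \<le> K * t ^ k" for k
    using K[of k] s assms(3) by (meson mult_left_mono order_trans power_mono less_imp_le)
  then show ?thesis using s assms by (auto simp: power_bounded_def)
qed

lemma power_bounded_gt:
  assumes "a \<in> S" "P a < s"
  shows "power_bounded P a s"
proof -
  have a: "0 \<le> P a" "0 \<le> P 1" using seminorm_nonneg[OF S P] assms subalgebra_one[OF S] by auto
  have "P (a ^ k) \<le> P 1 * s ^ k" for k
  proof -
    have "P 1 * P a ^ k \<le> P 1 * s ^ k"
      using a assms by (intro mult_left_mono power_mono) auto
    then show ?thesis using submult_power_le[OF S P sm assms(1), of k] by simp
  qed
  then show ?thesis using assms a by (auto simp: power_bounded_def)
qed

lemma spectral_le: "power_bounded P a s \<Longrightarrow> spectral_seminorm P a \<le> s"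
  unfolding spectral_seminorm_def
  by (rule cInf_lower) (auto intro!: bdd_belowI[of _ 0] simp: power_bounded_def)

lemma power_bounded_ex: "a \<in> S \<Longrightarrow> {s. power_bounded P a s} \<noteq> {}"
  using power_bounded_gt[of a "P a + 1"] by auto

lemma spectral_less: "a \<in> S \<Longrightarrow> spectral_seminorm P a < s \<Longrightarrow> power_bounded P a s"
  unfolding spectral_seminorm_def
  using cInf_lessD[OF power_bounded_ex] power_bounded_mono less_imp_le by blast

lemma spectral_ge: "a \<in> S \<Longrightarrow> (\<And>s. power_bounded P a s \<Longrightarrow> r \<le> s) \<Longrightarrow> r \<le> spectral_seminorm P a"
  unfolding spectral_seminorm_def using power_bounded_ex by (intro cInf_greatest) auto

lemma spectral_nonneg: "a \<in> S \<Longrightarrow> 0 \<le> spectral_seminorm P a"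
  by (rule spectral_ge) (auto simp: power_bounded_def)

lemma spectral_le_seminorm: "a \<in> S \<Longrightarrow> spectral_seminorm P a \<le> P a"
  using spectral_le power_bounded_gt by (meson dense_ge)

text \<open>By the binomial theorem, growth rates add while the constants \<open>K\<close> and
  \<open>L\<close> multiply. Commutativity enters here.\<close>

lemma power_bounded_add:
  assumes a: "a \<in> S" and b: "b \<in> S" and "power_bounded P a s" "power_bounded P b t"
  shows "power_bounded P (a + b) (s + t)"
proof -
  note cl = subalgebra_closed[OF S]
  obtain K where K: "\<And>k. P (a ^ k) \<le> K * s ^ k" and s: "0 < s"
    using assms by (auto simp: power_bounded_def)
  obtain L where L: "\<And>k. P (b ^ k) \<le> L * t ^ k" and t: "0 < t"
    using assms by (auto simp: power_bounded_def)
  have K0: "0 \<le> K" using K[of 0] seminorm_nonneg[OF S P, of 1] cl by simp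
  have "P ((a + b) ^ n) \<le> K * L * (s + t) ^ n" for n
  proof -
    have "(a + b) ^ n = (\<Sum>k\<le>n. smultC (of_nat (n choose k)) (a ^ k * b ^ (n - k)))"
      by (simp add: binomial_ring smultC_of_nat mult.assoc)
    then have "P ((a + b) ^ n) \<le> (\<Sum>k\<le>n. P (smultC (of_nat (n choose k)) (a ^ k * b ^ (n - k))))"
      using a b cl by (auto intro!: seminorm_sum[OF S P])
    also have "\<dots> \<le> (\<Sum>k\<le>n. K * L * (of_nat (n choose k) * s ^ k * t ^ (n - k)))"
    proof (rule sum_mono)
      fix k
      have "P (a ^ k * b ^ (n - k)) \<le> P (a ^ k) * P (b ^ (n - k))"
        using sm a b cl by (simp add: submultiplicative_on_def)
      also have "\<dots> \<le> (K * s ^ k) * (L * t ^ (n - k))"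
        using K L K0 s a b cl by (intro mult_mono seminorm_nonneg[OF S P]) auto
      finally have "of_nat (n choose k) * P (a ^ k * b ^ (n - k))
          \<le> of_nat (n choose k) * ((K * s ^ k) * (L * t ^ (n - k)))"
        by (intro mult_left_mono) auto
      then show "P (smultC (of_nat (n choose k)) (a ^ k * b ^ (n - k)))
          \<le> K * L * (of_nat (n choose k) * s ^ k * t ^ (n - k))"
        using a b cl by (simp add: seminorm_smultC[OF S P] mult_ac)
    qed
    also have "\<dots> = K * L * (s + t) ^ n"
      by (simp add: binomial_ring sum_distrib_left)
    finally show ?thesis .
  qed
  then show ?thesis using s t by (auto simp: power_bounded_def)
qed

lemma spectral_seminorm: "seminorm_on S (spectral_seminorm P)"
proof (rule seminorm_onI[OF S])
  note cl = subalgebra_closed[OF S]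
  fix a b c assume a: "a \<in> S"
  show "0 \<le> spectral_seminorm P a" by (fact spectral_nonneg[OF a])
  show "spectral_seminorm P (smultC c a) \<le> cmod c * spectral_seminorm P a"
  proof (cases "c = 0")
    case True
    then show ?thesis using spectral_le_seminorm[of 0] seminorm_zero[OF S P] cl by simp
  next
    case False
    have "spectral_seminorm P (smultC c a) / cmod c \<le> spectral_seminorm P a"
    proof (rule spectral_ge[OF a])
      fix s assume s: "power_bounded P a s"
      then obtain K where K: "\<And>k. P (a ^ k) \<le> K * s ^ k" by (auto simp: power_bounded_def)
      have "P (smultC c a ^ k) \<le> K * (cmod c * s) ^ k" for k
        using mult_left_mono[OF K[of k], of "cmod c ^ k"] a cl
        by (simp add: smultC_power seminorm_smultC[OF S P] norm_power power_mult_distrib mult_ac)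
      then have "power_bounded P (smultC c a) (cmod c * s)"
        using s False by (auto simp: power_bounded_def)
      then show "spectral_seminorm P (smultC c a) / cmod c \<le> s"
        using spectral_le False by (simp add: divide_simps mult.commute)
    qed
    then show ?thesis using False by (simp add: field_simps)
  qed
  assume b: "b \<in> S"
  show "spectral_seminorm P (a + b) \<le> spectral_seminorm P a + spectral_seminorm P b"
    by (rule le_add_by_approx) (intro spectral_le power_bounded_add spectral_less a b)
qed

text \<open>A rate \<open>s\<close> for \<open>a\<close> gives the rate \<open>s^2\<close> for
  \<open>a^2\<close>. Conversely, a rate \<open>s\<close> for \<open>a^2\<close> controls the even
  powers of \<open>a\<close> at rate \<open>sqrt s\<close>, and an odd power costs one extra factor
  \<open>P a\<close>.\<close>

lemma spectral_uniform: "uniform_on S (spectral_seminorm P)"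
  unfolding uniform_on_def
proof
  note cl = subalgebra_closed[OF S]
  fix a assume a: "a \<in> S"
  show "spectral_seminorm P (a^2) = spectral_seminorm P a ^ 2"
  proof (rule antisym)
    have "sqrt (spectral_seminorm P (a^2)) \<le> spectral_seminorm P a"
    proof (rule spectral_ge[OF a])
      fix s assume s: "power_bounded P a s"
      then obtain K where K: "\<And>k. P (a ^ k) \<le> K * s ^ k" by (auto simp: power_bounded_def)
      have "P ((a^2) ^ k) \<le> K * (s^2) ^ k" for k
        using K[of "2 * k"] by (simp add: power_mult)
      then have "power_bounded P (a^2) (s^2)" using s by (auto simp: power_bounded_def)
      then show "sqrt (spectral_seminorm P (a^2)) \<le> s"
        using s spectral_le by (intro real_le_lsqrt) (auto simp: power_bounded_def)
    qed
    then show "spectral_seminorm P (a^2) \<le> spectral_seminorm P a ^ 2" by (rule sqrt_le_D)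
    show "spectral_seminorm P a ^ 2 \<le> spectral_seminorm P (a^2)"
    proof (rule spectral_ge)
      fix s assume s: "power_bounded P (a^2) s"
      then obtain K where K: "\<And>k. P ((a^2) ^ k) \<le> K * s ^ k" and s0: "0 < s"
        by (auto simp: power_bounded_def)
      define r where "r = sqrt s"
      have r: "0 < r" "s = r^2" using s0 by (auto simp: r_def)
      have K0: "0 \<le> K" using K[of 0] seminorm_nonneg[OF S P, of 1] cl by simp
      have Pa: "0 \<le> P a" by (rule seminorm_nonneg[OF S P a])
      have even: "P (a ^ (2 * k)) \<le> K * r ^ (2 * k)" for k
        using K[of k] r by (simp add: power_mult)
      \<comment> \<open>The first summand of the constant serves even \<open>k\<close>. The second
        serves odd \<open>k\<close>, where dividing by \<open>r\<close> makes up for the missing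
        power.\<close>
      have "P (a ^ k) \<le> (K + P a * K / r) * r ^ k" for k
      proof (cases "even k")
        case True
        then have "P (a ^ k) \<le> K * r ^ k" using even by (auto elim: evenE)
        also have "\<dots> \<le> (K + P a * K / r) * r ^ k"
          using r K0 Pa by (intro mult_right_mono) auto
        finally show ?thesis .
      next
        case False
        then obtain j where j: "k = Suc (2 * j)" by (auto elim: oddE)
        have "P (a ^ k) \<le> P a * P (a ^ (2 * j))"
          using sm a cl j by (simp add: submultiplicative_on_def)
        also have "\<dots> \<le> P a * (K * r ^ (2 * j))" using even Pa by (intro mult_left_mono)
        also have "\<dots> = (P a * K / r) * r ^ k" using r j by simp
        also have "\<dots> \<le> (K + P a * K / r) * r ^ k"
          using r K0 Pa by (intro mult_right_mono) auto
        finally show ?thesis .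
      qed
      then have "power_bounded P a r" using r by (auto simp: power_bounded_def)
      then show "spectral_seminorm P a ^ 2 \<le> s"
        using spectral_le spectral_nonneg[OF a] r by (simp add: power_mono)
    qed (use a cl in auto)
  qed
qed

text \<open>A rate below 1 would make \<open>K * s ^ k\<close> tend to 0, although all powers of 1
  have the same value \<open>P 1 \<ge> 1\<close>.\<close>

lemma spectral_one:
  assumes "1 \<le> P 1"
  shows "spectral_seminorm P 1 = 1"
proof (rule antisym)
  have "power_bounded P 1 1" by (auto simp: power_bounded_def)
  then show "spectral_seminorm P 1 \<le> 1" by (rule spectral_le)
  show "1 \<le> spectral_seminorm P 1"
  proof (rule spectral_ge[OF subalgebra_one[OF S]], rule ccontr)
    fix s assume s: "power_bounded P 1 s" "\<not> 1 \<le> s"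
    then obtain K where K: "\<And>k. P 1 \<le> K * s ^ k" and s0: "0 < s" by (auto simp: power_bounded_def)
    have "(\<lambda>k. K * s ^ k) \<longlonglongrightarrow> K * 0"
      using s s0 by (intro tendsto_mult_left LIMSEQ_power_zero) simp
    then have "P 1 \<le> 0" using LIMSEQ_le_const[of _ "K * 0" "P 1"] K by auto
    then show False using assms by simp
  qed
qed

end

section \<open>Quotient seminorms, viewed on the algebra itself\<close>

definition quotient_seminorm :: "'a::calg set \<Rightarrow> ('a \<Rightarrow> real) \<Rightarrow> 'a \<Rightarrow> real" where
  "quotient_seminorm I P a = (INF i\<in>I. P (a + i))"

context
  fixes S :: "'a::calg set" and P I
  assumes S: "subalgebra S" and P: "seminorm_on S P" and sm: "submultiplicative_on S P"
    and I: "alg_ideal S I"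
begin

lemma ideal_subset: "i \<in> I \<Longrightarrow> i \<in> S"
  and ideal_zero: "0 \<in> I"
  and ideal_add: "i \<in> I \<Longrightarrow> j \<in> I \<Longrightarrow> i + j \<in> I"
  and ideal_smultC: "i \<in> I \<Longrightarrow> smultC c i \<in> I"
  and ideal_mult: "a \<in> S \<Longrightarrow> i \<in> I \<Longrightarrow> a * i \<in> I"
  using I by (auto simp: alg_ideal_def)

lemma quotient_le: "a \<in> S \<Longrightarrow> i \<in> I \<Longrightarrow> quotient_seminorm I P a \<le> P (a + i)"
  unfolding quotient_seminorm_def
  using seminorm_nonneg[OF S P] subalgebra_add[OF S] ideal_subset
  by (intro cINF_lower bdd_belowI[of _ 0]) auto

lemma quotient_ge: "(\<And>i. i \<in> I \<Longrightarrow> r \<le> P (a + i)) \<Longrightarrow> r \<le> quotient_seminorm I P a"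
  unfolding quotient_seminorm_def using ideal_zero by (intro cINF_greatest) auto

lemma quotient_less:
  assumes "a \<in> S" "quotient_seminorm I P a < s"
  obtains i where "i \<in> I" "P (a + i) < s"
  using assms quotient_ge[of s a] by (meson linorder_not_less)

lemma quotient_seminorm: "seminorm_on S (quotient_seminorm I P)"
proof (rule seminorm_onI[OF S])
  note cl = subalgebra_closed[OF S]
  fix a b c assume a: "a \<in> S"
  show "0 \<le> quotient_seminorm I P a"
    using seminorm_nonneg[OF S P] a ideal_subset cl by (intro quotient_ge) auto
  show "quotient_seminorm I P (smultC c a) \<le> cmod c * quotient_seminorm I P a"
  proof (cases "c = 0")
    case True
    then show ?thesis using quotient_le[of 0 0] seminorm_zero[OF S P] ideal_zero cl by simp
  next
    case False
    have "quotient_seminorm I P (smultC c a) / cmod c \<le> quotient_seminorm I P a"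
    proof (rule quotient_ge)
      fix i assume i: "i \<in> I"
      have "quotient_seminorm I P (smultC c a) \<le> P (smultC c (a + i))"
        using quotient_le[of "smultC c a" "smultC c i"] a i cl ideal_smultC
        by (simp add: smultC_add_right)
      then show "quotient_seminorm I P (smultC c a) / cmod c \<le> P (a + i)"
        using False a i cl ideal_subset by (simp add: seminorm_smultC[OF S P] divide_simps mult.commute)
    qed
    then show ?thesis using False by (simp add: field_simps)
  qed
  assume b: "b \<in> S"
  show "quotient_seminorm I P (a + b) \<le> quotient_seminorm I P a + quotient_seminorm I P b"
  proof (rule le_add_by_approx)
    fix s t assume "quotient_seminorm I P a < s" "quotient_seminorm I P b < t"
    then obtain i j where ij: "i \<in> I" "P (a + i) < s" "j \<in> I" "P (b + j) < t"
      using quotient_less a b by metis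
    have "quotient_seminorm I P (a + b) \<le> P ((a + i) + (b + j))"
      using quotient_le[of "a + b" "i + j"] a b ij cl ideal_add by (simp add: add_ac)
    also have "\<dots> \<le> P (a + i) + P (b + j)"
      using a b ij cl ideal_subset by (intro seminorm_add[OF S P]) auto
    finally show "quotient_seminorm I P (a + b) \<le> s + t" using ij by simp
  qed
qed

text \<open>The product of representatives \<open>a + i\<close> and \<open>b + j\<close> differs
  from \<open>a * b\<close> by an element of the ideal.\<close>

lemma quotient_submult: "submultiplicative_on S (quotient_seminorm I P)"
  unfolding submultiplicative_on_def
proof (intro ballI, rule le_mult_by_approx)
  note cl = subalgebra_closed[OF S]
  fix a b s t assume a: "a \<in> S" and b: "b \<in> S"
    and s: "quotient_seminorm I P a < s" and t: "quotient_seminorm I P b < t"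
  obtain i j where ij: "i \<in> I" "P (a + i) < s" "j \<in> I" "P (b + j) < t"
    using quotient_less[OF a s] quotient_less[OF b t] by metis
  have S': "a + i \<in> S" "b + j \<in> S" using a b ij cl ideal_subset by auto
  have "a * j + (b * i + i * j) \<in> I"
    by (intro ideal_add ideal_mult ideal_subset a b ij)
  then have "quotient_seminorm I P (a * b) \<le> P ((a + i) * (b + j))"
    using quotient_le[of "a * b" "a * j + (b * i + i * j)"] a b cl by (simp add: algebra_simps)
  also have "\<dots> \<le> P (a + i) * P (b + j)"
    using sm S' by (simp add: submultiplicative_on_def)
  also have "\<dots> \<le> s * t"
    using ij seminorm_nonneg[OF S P S'(1)] seminorm_nonneg[OF S P S'(2)] by (intro mult_mono) auto
  finally show "quotient_seminorm I P (a * b) \<le> s * t" .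
qed

lemma quotient_ideal_zero: "i \<in> I \<Longrightarrow> quotient_seminorm I P i \<le> 0"
  using quotient_le[of i "- i"] ideal_smultC[of i "-1"] ideal_subset seminorm_zero[OF S P]
  by (simp add: smultC_minus_one)

end

text \<open>Enlarges the radius from \<open>e\<close> to 1: a high power of \<open>x\<close> falls
  below \<open>e\<close>, and \<open>1 - x\<close> divides \<open>1 - x ^ Suc n\<close> by the
  finite geometric sum.\<close>

lemma one_minus_small_invertible:
  fixes S :: "'a::calg set"
  assumes S: "subalgebra S" and P: "seminorm_on S P" and sm: "submultiplicative_on S P"
    and e: "0 < e" and inv: "\<And>x. x \<in> S \<Longrightarrow> P x < e \<Longrightarrow> \<exists>y\<in>S. (1 - x) * y = 1"
    and x: "x \<in> S" "P x < 1"
  shows "\<exists>y\<in>S. (1 - x) * y = 1"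
proof -
  note cl = subalgebra_closed[OF S]
  obtain n where n: "P x ^ n < e" using real_arch_pow_inv[OF e x(2)] by blast
  have Px: "0 \<le> P x" by (rule seminorm_nonneg[OF S P x(1)])
  have "P (x ^ Suc n) \<le> P x ^ Suc n" by (rule submult_power_le'[OF S P sm x(1)]) simp
  also have "\<dots> \<le> P x ^ n" using Px x by (intro power_decreasing) auto
  finally obtain y where y: "y \<in> S" "(1 - x ^ Suc n) * y = 1"
    using inv[of "x ^ Suc n"] n x cl by (metis order_le_less_trans)
  have "(1 - x) * ((\<Sum>i<Suc n. x ^ i) * y) = 1"
    using y(2) unfolding one_diff_power_eq by (simp add: mult.assoc)
  moreover have "(\<Sum>i<Suc n. x ^ i) * y \<in> S"
    using y(1) x by (intro cl(4) subalgebra_sum[OF S] cl(8))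
  ultimately show ?thesis by blast
qed

text \<open>If \<open>P (1 + j) < 1\<close> for some \<open>j\<close> in \<open>I\<close>, then
  \<open>- j\<close> would be invertible and \<open>I\<close> would contain 1. So the quotient
  seminorm of 1 is at least 1, its spectral seminorm at 1 equals 1, and a character dominated by the
  latter vanishes on \<open>I\<close>.\<close>

lemma proper_ideal_character:
  fixes S :: "'a::calg set"
  assumes S: "subalgebra S" and P: "seminorm_on S P" and sm: "submultiplicative_on S P"
    and e: "0 < e" and inv: "\<And>x. x \<in> S \<Longrightarrow> P x < e \<Longrightarrow> \<exists>y\<in>S. (1 - x) * y = 1"
    and I: "alg_ideal S I" "I \<noteq> S"
  obtains f where "f \<in> Mstar S" "\<And>i. i \<in> I \<Longrightarrow> f i = 0"
proof -
  note cl = subalgebra_closed[OF S]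
  note i = S P sm I(1)
  let ?Q = "quotient_seminorm I P"
  note Q = S quotient_seminorm[OF i] quotient_submult[OF i]
  have notone: "1 \<notin> I"
  proof
    assume "1 \<in> I"
    then have "a \<in> I" if "a \<in> S" for a using ideal_mult[OF i that, of 1] by simp
    then show False using I ideal_subset[OF i] by blast
  qed
  have "1 \<le> ?Q 1"
  proof (rule quotient_ge[OF i], rule ccontr)
    fix j assume j: "j \<in> I" "\<not> 1 \<le> P (1 + j)"
    then obtain y where y: "y \<in> S" "(1 - (1 + j)) * y = 1"
      using one_minus_small_invertible[OF S P sm e inv, of "1 + j"] cl ideal_subset[OF i] by auto
    have "1 = (- y) * j" using y by (simp add: mult.commute)
    then show False using notone ideal_mult[OF i, of "- y" j] j y cl by auto
  qed
  then have one: "spectral_seminorm ?Q 1 = 1" by (rule spectral_one[OF Q])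
  obtain f where f: "f \<in> Mstar S" "\<And>a. a \<in> S \<Longrightarrow> cmod (f a) \<le> spectral_seminorm ?Q a"
    using uniform_seminorm_character[OF S spectral_seminorm[OF Q] spectral_uniform[OF Q] cl(1)] one
    by (metis zero_less_one)
  have "f j = 0" if "j \<in> I" for j
  proof -
    have "j \<in> S" by (rule ideal_subset[OF i that])
    then have "cmod (f j) \<le> 0"
      using f(2)[of j] spectral_le_seminorm[OF Q, of j] quotient_ideal_zero[OF i that] by linarith
    then show ?thesis by simp
  qed
  then show thesis using that f by blast
qed

section \<open>Kernels and bounds of characters\<close>

lemma Mstar_add: "f \<in> Mstar S \<Longrightarrow> x \<in> S \<Longrightarrow> y \<in> S \<Longrightarrow> f (x + y) = f x + f y"
  and Mstar_smultC: "f \<in> Mstar S \<Longrightarrow> x \<in> S \<Longrightarrow> f (smultC c x) = c * f x"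
  and Mstar_mult: "f \<in> Mstar S \<Longrightarrow> x \<in> S \<Longrightarrow> y \<in> S \<Longrightarrow> f (x * y) = f x * f y"
  by (auto simp: Mstar_def)

context
  fixes S :: "'a::calg set" and f
  assumes S: "subalgebra S" and f: "f \<in> Mstar S"
begin

lemma Mstar_one: "f 1 = 1"
proof -
  obtain x where "x \<in> S" "f x \<noteq> 0" using f by (auto simp: Mstar_def)
  then show ?thesis using Mstar_mult[OF f, of 1 x] subalgebra_one[OF S] by simp
qed

lemma Mstar_zero: "f 0 = 0"
  using Mstar_smultC[OF f subalgebra_zero[OF S], of 0] by simp

lemma Mstar_diff: "x \<in> S \<Longrightarrow> y \<in> S \<Longrightarrow> f (x - y) = f x - f y"
  using Mstar_add[OF f, of "x - y" y] subalgebra_closed[OF S] by (simp add: algebra_simps)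

lemma Mstar_power: "x \<in> S \<Longrightarrow> f (x ^ n) = f x ^ n"
  by (induction n) (auto simp: Mstar_one Mstar_mult[OF f] subalgebra_closed[OF S])

text \<open>For \<open>y\<close> outside the kernel, every \<open>x\<close> differs from the
  multiple \<open>(f x / f y) y\<close> by an element of the kernel, so a larger ideal is
  everything.\<close>

lemma Mstar_kernel_maximal: "maximal_ideal S {x\<in>S. f x = 0}"
  unfolding maximal_ideal_def
proof (intro conjI allI impI)
  note cl = subalgebra_closed[OF S]
  show "alg_ideal S {x\<in>S. f x = 0}"
    unfolding alg_ideal_def
    using Mstar_zero cl Mstar_add[OF f] Mstar_smultC[OF f] Mstar_mult[OF f] by auto
  have "1 \<notin> {x\<in>S. f x = 0}" using Mstar_one by simp
  then show "{x\<in>S. f x = 0} \<noteq> S" using cl(1) by blast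
  fix J assume J: "alg_ideal S J \<and> {x\<in>S. f x = 0} \<subseteq> J \<and> J \<noteq> S"
  show "J = {x\<in>S. f x = 0}"
  proof (rule ccontr)
    assume "J \<noteq> {x\<in>S. f x = 0}"
    then obtain y where y: "y \<in> J" "y \<in> S" "f y \<noteq> 0" using J by (auto simp: alg_ideal_def)
    have "x \<in> J" if x: "x \<in> S" for x
    proof -
      have "x - smultC (f x / f y) y \<in> {x\<in>S. f x = 0}"
        using x y cl by (simp add: Mstar_diff Mstar_smultC[OF f])
      then have "x - smultC (f x / f y) y \<in> J" "smultC (f x / f y) y \<in> J"
        using J y by (auto simp: alg_ideal_def)
      then have "x - smultC (f x / f y) y + smultC (f x / f y) y \<in> J"
        using J unfolding alg_ideal_def by blast
      then show ?thesis by simp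
    qed
    then show False using J by (auto simp: alg_ideal_def)
  qed
qed

text \<open>If the bound failed at \<open>x\<close>, the normalised \<open>y = x / f x\<close> would
  satisfy \<open>f y = 1\<close> and \<open>P y < 1\<close>; its powers keep the value 1 while their
  seminorms tend to 0. The hypothesis on the \<open>e\<close>-ball comes from invertibility of
  \<open>1 - z\<close> in one application and from continuity at 0 in the other.\<close>

lemma Mstar_le_seminorm:
  assumes P: "seminorm_on S P" and sm: "submultiplicative_on S P" and e: "0 < e"
    and ne: "\<And>z. z \<in> S \<Longrightarrow> P z < e \<Longrightarrow> f z \<noteq> 1" and x: "x \<in> S"
  shows "cmod (f x) \<le> P x"
proof (rule ccontr)
  note cl = subalgebra_closed[OF S]
  assume less: "\<not> cmod (f x) \<le> P x"
  define y where "y = smultC (1 / f x) x"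
  have Px: "0 \<le> P x" by (rule seminorm_nonneg[OF S P x])
  have fx: "f x \<noteq> 0" using less Px by auto
  have y: "y \<in> S" "f y = 1" using x cl fx by (auto simp: y_def Mstar_smultC[OF f])
  have Py: "P y < 1" "0 \<le> P y"
    using less fx x seminorm_nonneg[OF S P y(1)]
    by (auto simp: y_def seminorm_smultC[OF S P] norm_divide divide_simps)
  obtain n where n: "P y ^ n < e" using real_arch_pow_inv[OF e Py(1)] by blast
  have "P (y ^ Suc n) \<le> P y ^ Suc n" by (rule submult_power_le'[OF S P sm y(1)]) simp
  also have "\<dots> \<le> P y ^ n" using Py by (intro power_decreasing) auto
  finally have "P (y ^ Suc n) < e" using n by simp
  then show False using ne[of "y ^ Suc n"] Mstar_power[OF y(1), of "Suc n"] y cl by simp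
qed

end

section \<open>Extension of characters by density\<close>

lemma seminorm_mult_diff_le:
  assumes S: "subalgebra S" and P: "seminorm_on S P" and sm: "submultiplicative_on S P"
    and x: "x \<in> S" and y: "y \<in> S" and c: "c \<in> S" and d: "d \<in> S"
  shows "P (x * y - c * d) \<le> P (x - c) * P (y - d) + (P (x - c) * P d + P c * P (y - d))"
proof -
  note cl = subalgebra_closed[OF S]
  have mem: "x - c \<in> S" "y - d \<in> S" using x y c d cl by auto
  \<comment> \<open>Expanding around \<open>(c, d)\<close> leaves only differences and the fixed
    elements \<open>c\<close> and \<open>d\<close>, so the bound tends to 0 as \<open>x\<close> and
    \<open>y\<close> approach them.\<close>
  have "P (x * y - c * d) = P ((x - c) * (y - d) + ((x - c) * d + c * (y - d)))"
    by (simp add: algebra_simps)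
  also have "\<dots> \<le> P ((x - c) * (y - d)) + P ((x - c) * d + c * (y - d))"
    by (intro seminorm_add[OF S P] cl x y c d)
  also have "\<dots> \<le> P ((x - c) * (y - d)) + (P ((x - c) * d) + P (c * (y - d)))"
    by (intro add_left_mono seminorm_add[OF S P] cl x y c d)
  also have "\<dots> \<le> P (x - c) * P (y - d) + (P (x - c) * P d + P c * P (y - d))"
    using sm mem c d by (intro add_mono) (auto simp: submultiplicative_on_def)
  finally show ?thesis .
qed

text \<open>Domination by \<open>P\<close> makes the values of \<open>f\<close> along an
  approximating sequence Cauchy, with a limit that does not depend on the sequence. Identities then
  follow because sums, products and multiples of approximating sequences approximate the
  corresponding elements.\<close>

lemma Mstar_extension:
  fixes C D :: "'a::calg set"
  assumes C: "subalgebra C" and D: "subalgebra D" "D \<subseteq> C"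
    and P: "seminorm_on C P" and sm: "submultiplicative_on C P"
    and dense: "\<And>c e. c \<in> C \<Longrightarrow> 0 < e \<Longrightarrow> \<exists>x\<in>D. P (x - c) < e"
    and f: "f \<in> Mstar D" and le: "\<And>x. x \<in> D \<Longrightarrow> cmod (f x) \<le> P x"
  obtains g where "g \<in> Mstar C" "\<And>x. x \<in> D \<Longrightarrow> g x = f x" "\<And>c. c \<in> C \<Longrightarrow> cmod (g c) \<le> P c"
proof -
  note cl = subalgebra_closed[OF C] and cd = subalgebra_closed[OF D(1)]
  have DC: "x \<in> C" if "x \<in> D" for x using that D by blast
  \<comment> \<open>Only one seminorm is involved, so sequences suffice and no nets are
    required.\<close>
  define appr where "appr v c \<longleftrightarrow> range v \<subseteq> D \<and> (\<lambda>n. P (v n - c)) \<longlonglongrightarrow> 0" for v :: "nat \<Rightarrow> 'a" and c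
  have apprI: "appr v c"
    if "\<And>n. v n \<in> D" "c \<in> C" "\<And>n. P (v n - c) \<le> h n" "h \<longlonglongrightarrow> 0" for v c h
    unfolding appr_def
  proof (intro conjI)
    show "(\<lambda>n. P (v n - c)) \<longlonglongrightarrow> 0"
      using that cl DC
      by (intro tendsto_sandwich[OF _ _ tendsto_const that(4)])
         (auto intro!: always_eventually seminorm_nonneg[OF C P])
  qed (use that in auto)
  have "\<exists>v. appr v c" if c: "c \<in> C" for c
  proof -
    have "\<exists>x. x \<in> D \<and> P (x - c) < 1 / real (Suc n)" for n using dense[OF c, of "1 / real (Suc n)"] by auto
    then obtain v where v: "\<And>n. v n \<in> D" "\<And>n. P (v n - c) < 1 / real (Suc n)" by metis
    have "appr v c"
      using v c by (intro apprI[OF _ _ _ LIMSEQ_Suc[OF lim_const_over_n[of "1::real"]]]) (auto intro: less_imp_le)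
    then show ?thesis by (intro exI[of _ v])
  qed
  then obtain u where u: "\<And>c. c \<in> C \<Longrightarrow> appr (u c) c" by metis
  define g where "g c = lim (\<lambda>n. f (u c n))" for c
  have diff: "cmod (f x - f y) \<le> P (x - c) + P (y - c)" if "x \<in> D" "y \<in> D" "c \<in> C" for x y c
  proof -
    have "cmod (f x - f y) \<le> P (x - y)"
      using le[of "x - y"] Mstar_diff[OF D(1) f] that cd by simp
    also have "\<dots> \<le> P (x - c) + P (c - y)"
      using that DC by (intro seminorm_triangle_diff[OF C P]) auto
    finally show ?thesis using seminorm_minus_commute[OF C P, of c y] that DC by simp
  qed
  have lim: "(\<lambda>n. f (v n)) \<longlonglongrightarrow> g c" if v: "appr v c" and c: "c \<in> C" for v c
  proof -
    have uD: "u c n \<in> D" "v n \<in> D" for n using u[OF c] v by (auto simp: appr_def)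
    have u0: "(\<lambda>n. P (u c n - c)) \<longlonglongrightarrow> 0" using u[OF c] by (simp add: appr_def)
    have v0: "(\<lambda>n. P (v n - c)) \<longlonglongrightarrow> 0" using v by (simp add: appr_def)
    have "Cauchy (\<lambda>n. f (u c n))"
    proof (rule metric_CauchyI)
      fix e :: real assume e: "0 < e"
      then obtain N where N: "\<And>n. N \<le> n \<Longrightarrow> P (u c n - c) < e / 2"
        using order_tendstoD(2)[OF u0, of "e / 2"] by (auto simp: eventually_sequentially)
      have "dist (f (u c m)) (f (u c n)) < e" if "N \<le> m" "N \<le> n" for m n
        using diff[OF uD(1) uD(1) c, of m n] N[OF that(1)] N[OF that(2)] by (simp add: dist_norm)
      then show "\<exists>N. \<forall>m\<ge>N. \<forall>n\<ge>N. dist (f (u c m)) (f (u c n)) < e" by blast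
    qed
    then have 1: "(\<lambda>n. f (u c n)) \<longlonglongrightarrow> g c"
      unfolding g_def by (simp add: Cauchy_convergent convergent_LIMSEQ_iff[symmetric])
    \<comment> \<open>Any approximating sequence is compared with the chosen one \<open>u c\<close>,
      which gives independence of the choice.\<close>
    have "(\<lambda>n. f (v n) - f (u c n)) \<longlonglongrightarrow> 0"
    proof (rule Lim_null_comparison)
      show "\<forall>\<^sub>F n in sequentially. norm (f (v n) - f (u c n)) \<le> P (v n - c) + P (u c n - c)"
        using diff uD c by (intro always_eventually) auto
      show "(\<lambda>n. P (v n - c) + P (u c n - c)) \<longlonglongrightarrow> 0" using tendsto_add[OF v0 u0] by simp
    qed
    then show ?thesis using tendsto_add[OF _ 1] by fastforce
  qed
  have on_D: "g x = f x" if x: "x \<in> D" for x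
  proof -
    have "appr (\<lambda>n. x) x" using x seminorm_zero[OF C P] by (auto simp: appr_def)
    from lim[OF this] show ?thesis using x DC LIMSEQ_unique tendsto_const by metis
  qed
  have props: "u c n \<in> D" "(\<lambda>n. P (u c n - c)) \<longlonglongrightarrow> 0" "(\<lambda>n. f (u c n)) \<longlonglongrightarrow> g c" if "c \<in> C" for c n
    using u[OF that] lim[OF u that] that by (auto simp: appr_def)
  have bound: "cmod (g c) \<le> P c" if c: "c \<in> C" for c
  proof -
    have "cmod (f (u c n)) \<le> P (u c n - c) + P c" for n
      using le[OF props(1)[OF c], of n] seminorm_add[OF C P, of "u c n - c" c] props(1)[OF c] c cl DC by fastforce
    then show ?thesis
      using LIMSEQ_le[OF tendsto_norm[OF props(3)[OF c]] tendsto_add[OF props(2)[OF c] tendsto_const, of "P c"]]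
      by simp
  qed
  have "g \<in> Mstar C"
    unfolding Mstar_def
  proof (intro CollectI conjI ballI allI)
    fix c d k assume c: "c \<in> C"
    have "appr (\<lambda>n. smultC k (u c n)) (smultC k c)"
    proof (rule apprI)
      fix n
      have "smultC k (u c n) - smultC k c = smultC k (u c n - c)"
        by (simp add: smultC_conv_mult[of k "u c n"] smultC_conv_mult[of k c] smultC_conv_mult[of k "u c n - c"] algebra_simps)
      then show "P (smultC k (u c n) - smultC k c) \<le> cmod k * P (u c n - c)"
        using seminorm_smultC[OF C P, of "u c n - c" k] c cl DC props(1)[OF c] by simp
      show "(\<lambda>n. cmod k * P (u c n - c)) \<longlonglongrightarrow> 0"
        using tendsto_mult_left[OF props(2)[OF c], of "cmod k"] by simp
    qed (use c cl cd props(1) in auto)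
    from lim[OF this] tendsto_mult_left[OF props(3)[OF c], of k]
    show "g (smultC k c) = k * g c"
      using c cl props(1)[OF c] by (simp add: Mstar_smultC[OF f] LIMSEQ_unique)
    assume d: "d \<in> C"
    have "appr (\<lambda>n. u c n + u d n) (c + d)"
    proof (rule apprI)
      fix n
      show "P (u c n + u d n - (c + d)) \<le> P (u c n - c) + P (u d n - d)"
        using seminorm_add[OF C P, of "u c n - c" "u d n - d"] c d cl DC props(1)[OF c] props(1)[OF d]
        by (simp add: algebra_simps)
      show "(\<lambda>n. P (u c n - c) + P (u d n - d)) \<longlonglongrightarrow> 0"
        using tendsto_add[OF props(2)[OF c] props(2)[OF d]] by simp
    qed (use c d cl cd props(1) in auto)
    from lim[OF this] tendsto_add[OF props(3)[OF c] props(3)[OF d]]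
    show "g (c + d) = g c + g d"
      using c d cl props(1) by (simp add: Mstar_add[OF f] LIMSEQ_unique)
    have "appr (\<lambda>n. u c n * u d n) (c * d)"
    proof (rule apprI)
      fix n
      have mem: "u c n \<in> C" "u d n \<in> C" using props(1) c d DC by auto
      show "P (u c n * u d n - c * d)
        \<le> P (u c n - c) * P (u d n - d) + (P (u c n - c) * P d + P c * P (u d n - d))"
        by (rule seminorm_mult_diff_le[OF C P sm mem c d])
      show "(\<lambda>n. P (u c n - c) * P (u d n - d) + (P (u c n - c) * P d + P c * P (u d n - d))) \<longlonglongrightarrow> 0"
        using props(2)[OF c] props(2)[OF d] by (auto intro!: tendsto_eq_intros)
    qed (use c d cl cd props(1) in auto)
    from lim[OF this] tendsto_mult[OF props(3)[OF c] props(3)[OF d]]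
    show "g (c * d) = g c * g d"
      using c d cl props(1) by (simp add: Mstar_mult[OF f] LIMSEQ_unique)
  next
    have "g 1 = 1" using on_D[OF cd(1)] Mstar_one[OF D(1) f] by simp
    then show "\<exists>x\<in>C. g x \<noteq> 0" using cl(1) by (intro bexI[of _ 1]) auto
  qed
  then show thesis using that on_D bound by blast
qed

section \<open>Seminorm topologies\<close>

text \<open>\<open>topology\<close> can be unfolded only after its argument is shown to satisfy
  \<open>istopology\<close>; intersections use the union of the finite sets and the smaller
  radius.\<close>

lemma openin_seminorm_topology:
  "openin (seminorm_topology S Q) U \<longleftrightarrow> U \<subseteq> S \<and> (\<forall>x\<in>U. \<exists>F e. finite F \<and> F \<subseteq> Q \<and> 0 < e
      \<and> {y\<in>S. \<forall>p\<in>F. p (y - x) < e} \<subseteq> U)"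
proof -
  let ?nb = "\<lambda>x F e. {y\<in>S. \<forall>p\<in>F. p (y - x) < e}"
  let ?op = "\<lambda>U. U \<subseteq> S \<and> (\<forall>x\<in>U. \<exists>F e. finite F \<and> F \<subseteq> Q \<and> 0 < e \<and> ?nb x F e \<subseteq> U)"
  have "istopology ?op"
    unfolding istopology_def
  proof (intro conjI allI impI)
    fix U V assume U: "?op U" and V: "?op V"
    show "U \<inter> V \<subseteq> S" using U by blast
    show "\<forall>x\<in>U \<inter> V. \<exists>F e. finite F \<and> F \<subseteq> Q \<and> 0 < e \<and> ?nb x F e \<subseteq> U \<inter> V"
    proof
      fix x assume x: "x \<in> U \<inter> V"
      obtain F d where F: "finite F" "F \<subseteq> Q" "0 < d" "?nb x F d \<subseteq> U" using U x by blast
      obtain G e where G: "finite G" "G \<subseteq> Q" "0 < e" "?nb x G e \<subseteq> V" using V x by blast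
      have "?nb x (F \<union> G) (min d e) \<subseteq> U \<inter> V" using F(4) G(4) by auto
      then show "\<exists>F e. finite F \<and> F \<subseteq> Q \<and> 0 < e \<and> ?nb x F e \<subseteq> U \<inter> V"
        using F G by (intro exI[of _ "F \<union> G"] exI[of _ "min d e"]) auto
    qed
  next
    fix K assume K: "\<forall>U\<in>K. ?op U"
    then show "\<Union>K \<subseteq> S" by blast
    show "\<forall>x\<in>\<Union>K. \<exists>F e. finite F \<and> F \<subseteq> Q \<and> 0 < e \<and> ?nb x F e \<subseteq> \<Union>K"
    proof
      fix x assume "x \<in> \<Union>K"
      then obtain U where U: "U \<in> K" "x \<in> U" by blast
      have "?op U" by (rule bspec[OF K U(1)])
      then obtain F e where F: "finite F" "F \<subseteq> Q" "0 < e" "?nb x F e \<subseteq> U" using U by blast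
      have "?nb x F e \<subseteq> \<Union>K" by (rule order_trans[OF F(4) Union_upper[OF U(1)]])
      with F show "\<exists>F e. finite F \<and> F \<subseteq> Q \<and> 0 < e \<and> ?nb x F e \<subseteq> \<Union>K"
        by (intro exI[of _ F] exI[of _ e] conjI)
    qed
  qed
  then show ?thesis unfolding seminorm_topology_def by (simp only: topology_inverse')
qed

section \<open>Finite sums of seminorms\<close>

lemma seminorm_on_subset: "seminorm_on S p \<Longrightarrow> T \<subseteq> S \<Longrightarrow> seminorm_on T p"
  unfolding seminorm_on_def by blast

lemma submultiplicative_on_subset: "submultiplicative_on S p \<Longrightarrow> T \<subseteq> S \<Longrightarrow> submultiplicative_on T p"
  unfolding submultiplicative_on_def by blast

text \<open>Sums let a basic neighbourhood, given by finitely many seminorms, be handled through one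
  seminorm. The empty set gives the zero seminorm.\<close>

lemma seminorm_on_sum:
  assumes "\<And>p. p \<in> F \<Longrightarrow> seminorm_on S p"
  shows "seminorm_on S (\<lambda>x. \<Sum>p\<in>F. p x)"
  unfolding seminorm_on_def
proof (intro conjI ballI allI)
  fix x y c assume x: "x \<in> S"
  show "0 \<le> (\<Sum>p\<in>F. p x)" using assms x by (auto intro!: sum_nonneg simp: seminorm_on_def)
  show "(\<Sum>p\<in>F. p (smultC c x)) = cmod c * (\<Sum>p\<in>F. p x)"
    using assms x by (auto intro!: sum.cong simp: seminorm_on_def sum_distrib_left)
  assume y: "y \<in> S"
  show "(\<Sum>p\<in>F. p (x + y)) \<le> (\<Sum>p\<in>F. p x) + (\<Sum>p\<in>F. p y)"
    unfolding sum.distrib[symmetric] using assms x y by (auto intro!: sum_mono simp: seminorm_on_def)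
qed

text \<open>The terms \<open>p x * p y\<close> are the diagonal part of the product of the two sums,
  and the remaining terms are nonnegative.\<close>

lemma submultiplicative_on_sum:
  assumes "finite F" "\<And>p. p \<in> F \<Longrightarrow> seminorm_on S p" "\<And>p. p \<in> F \<Longrightarrow> submultiplicative_on S p"
  shows "submultiplicative_on S (\<lambda>x. \<Sum>p\<in>F. p x)"
  unfolding submultiplicative_on_def
proof (intro ballI)
  fix x y assume xy: "x \<in> S" "y \<in> S"
  have nn: "0 \<le> p x" "0 \<le> p y" if "p \<in> F" for p using assms(2)[OF that] xy by (auto simp: seminorm_on_def)
  have "(\<Sum>p\<in>F. p (x * y)) \<le> (\<Sum>p\<in>F. p x * p y)"
    using assms(3) xy by (auto intro!: sum_mono simp: submultiplicative_on_def)
  also have "\<dots> \<le> (\<Sum>p\<in>F. p x * (\<Sum>r\<in>F. r y))"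
    using nn assms(1) by (intro sum_mono mult_left_mono member_le_sum) auto
  finally show "(\<Sum>p\<in>F. p (x * y)) \<le> (\<Sum>p\<in>F. p x) * (\<Sum>p\<in>F. p y)" by (simp add: sum_distrib_right)
qed

context
  fixes Q :: "('b::calg \<Rightarrow> real) set"
  assumes seminorms: "\<forall>p\<in>Q. seminorm_on UNIV p"
begin

private lemmas Q = bspec[OF seminorms]

lemma sum_seminorms_zero: "F \<subseteq> Q \<Longrightarrow> (\<Sum>p\<in>F. p 0) = 0"
  by (rule seminorm_zero[OF subalgebra_UNIV seminorm_on_sum[of F UNIV]]) (auto intro: Q)

lemma sum_ball_open:
  assumes F: "finite F" "F \<subseteq> Q"
  shows "openin (seminorm_topology UNIV Q) {y. (\<Sum>p\<in>F. p (y - x)) < e}"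
  unfolding openin_seminorm_topology
proof (intro conjI ballI)
  note P = subalgebra_UNIV seminorm_on_sum[of F UNIV, OF Q]
  fix y assume y: "y \<in> {y. (\<Sum>p\<in>F. p (y - x)) < e}"
  \<comment> \<open>The \<open>+ 1\<close> avoids division by zero for empty \<open>F\<close> and
    makes \<open>card F * d\<close> strictly smaller than the remaining room.\<close>
  define d where "d = (e - (\<Sum>p\<in>F. p (y - x))) / (card F + 1)"
  have d: "0 < d" using y by (simp add: d_def)
  have dd: "real (card F) * d < e - (\<Sum>p\<in>F. p (y - x))"
    using y by (simp add: d_def divide_simps algebra_simps)
  have "{z \<in> UNIV. \<forall>p\<in>F. p (z - y) < d} \<subseteq> {y. (\<Sum>p\<in>F. p (y - x)) < e}"
  proof
    fix z assume "z \<in> {z \<in> UNIV. \<forall>p\<in>F. p (z - y) < d}"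
    then have "(\<Sum>p\<in>F. p (z - y)) \<le> real (card F) * d" by (intro sum_bounded_above) auto
    moreover have "(\<Sum>p\<in>F. p (z - x)) \<le> (\<Sum>p\<in>F. p (z - y)) + (\<Sum>p\<in>F. p (y - x))"
      using F by (intro seminorm_triangle_diff[OF P]) auto
    ultimately show "z \<in> {y. (\<Sum>p\<in>F. p (y - x)) < e}" using dd by simp
  qed
  then show "\<exists>F' e'. finite F' \<and> F' \<subseteq> Q \<and> 0 < e' \<and> {z \<in> UNIV. \<forall>p\<in>F'. p (z - y) < e'} \<subseteq> {y. (\<Sum>p\<in>F. p (y - x)) < e}"
    using F d by (intro exI[of _ F] exI[of _ d]) simp
qed simp

lemma open_contains_sum_ball:
  assumes "openin (seminorm_topology UNIV Q) U" "x \<in> U"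
  obtains F e where "finite F" "F \<subseteq> Q" "0 < e" "{y. (\<Sum>p\<in>F. p (y - x)) < e} \<subseteq> U"
proof -
  obtain F e where F: "finite F" "F \<subseteq> Q" "0 < e" "{y\<in>UNIV. \<forall>p\<in>F. p (y - x) < e} \<subseteq> U"
    using assms unfolding openin_seminorm_topology by blast
  have le: "p (y - x) \<le> (\<Sum>p\<in>F. p (y - x))" if "p \<in> F" for p y
    using F Q that by (intro member_le_sum) (auto simp: seminorm_on_def)
  have "{y. (\<Sum>p\<in>F. p (y - x)) < e} \<subseteq> {y\<in>UNIV. \<forall>p\<in>F. p (y - x) < e}"
  proof (intro subsetI CollectI conjI UNIV_I ballI)
    fix y p assume "y \<in> {y. (\<Sum>p\<in>F. p (y - x)) < e}" "p \<in> F"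
    then show "p (y - x) < e" using le[of p y] by simp
  qed
  with F(4) have "{y. (\<Sum>p\<in>F. p (y - x)) < e} \<subseteq> U" by (rule order_trans[rotated])
  then show thesis by (rule that[OF F(1-3)])
qed

lemma topspace_seminorm_topology: "topspace (seminorm_topology UNIV Q) = UNIV"
  using sum_ball_open[of "{}" 0 1] openin_subset by fastforce

text \<open>Reduces closure in the topology to density for one seminorm at a time, the form in which
  \<open>Mstar_extension\<close> uses it.\<close>

lemma in_closure_iff_sum_ball:
  "c \<in> seminorm_topology UNIV Q closure_of D \<longleftrightarrow>
    (\<forall>F e. finite F \<and> F \<subseteq> Q \<and> 0 < e \<longrightarrow> (\<exists>x\<in>D. (\<Sum>p\<in>F. p (x - c)) < e))"
  (is "?l \<longleftrightarrow> ?r")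
proof
  assume l: ?l
  show ?r
  proof (intro allI impI)
    fix F e assume F: "finite F \<and> F \<subseteq> Q \<and> (0::real) < e"
    then have "c \<in> {y. (\<Sum>p\<in>F. p (y - c)) < e}" using sum_seminorms_zero by simp
    moreover have "openin (seminorm_topology UNIV Q) {y. (\<Sum>p\<in>F. p (y - c)) < e}"
      using F by (intro sum_ball_open) auto
    ultimately obtain y where "y \<in> D" "y \<in> {y. (\<Sum>p\<in>F. p (y - c)) < e}"
      using l unfolding in_closure_of by meson
    then show "\<exists>x\<in>D. (\<Sum>p\<in>F. p (x - c)) < e" by auto
  qed
next
  assume r: ?r
  show ?l
    unfolding in_closure_of topspace_seminorm_topology
  proof (intro conjI allI impI)
    fix T assume "c \<in> T \<and> openin (seminorm_topology UNIV Q) T"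
    then obtain F e where F: "finite F" "F \<subseteq> Q" "0 < e" "{y. (\<Sum>p\<in>F. p (y - c)) < e} \<subseteq> T"
      using open_contains_sum_ball[of T c] by auto
    then obtain x where "x \<in> D" "(\<Sum>p\<in>F. p (x - c)) < e" using r[rule_format, of F e] by auto
    then show "\<exists>y. y \<in> D \<and> y \<in> T" using F(4) by auto
  qed simp
qed

lemma subset_seminorm_closure: "D \<subseteq> seminorm_topology UNIV Q closure_of D"
  by (simp add: closure_of_subset topspace_seminorm_topology)

lemma subalgebra_closure:
  assumes D: "subalgebra D" and sm: "\<And>p. p \<in> Q \<Longrightarrow> submultiplicative_on UNIV p"
  shows "subalgebra (seminorm_topology UNIV Q closure_of D)"
  unfolding subalgebra_def
proof (intro conjI ballI allI)
  let ?C = "seminorm_topology UNIV Q closure_of D"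
  note cd = subalgebra_closed[OF D]
  show "1 \<in> ?C" using subset_seminorm_closure cd by blast
  fix c d k assume c: "c \<in> ?C"
  have closeI: "a \<in> ?C" if "\<And>F e. finite F \<Longrightarrow> F \<subseteq> Q \<Longrightarrow> 0 < e \<Longrightarrow> \<exists>x\<in>D. (\<Sum>p\<in>F. p (x - a)) < e" for a
    unfolding in_closure_iff_sum_ball by (intro allI impI, elim conjE) (rule that)
  have close: "\<exists>x\<in>D. (\<Sum>p\<in>F. p (x - a)) < e" if "a \<in> ?C" "finite F" "F \<subseteq> Q" "0 < e" for a F e
    using that(1)[unfolded in_closure_iff_sum_ball, rule_format, of F e] that(2-) by simp
  show "smultC k c \<in> ?C"
  proof (rule closeI)
    fix F e assume F: "finite F" "F \<subseteq> Q" "(0::real) < e"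
    \<comment> \<open>The \<open>+ 1\<close> keeps the denominator positive when
      \<open>k = 0\<close>.\<close>
    then obtain x where x: "x \<in> D" "(\<Sum>p\<in>F. p (x - c)) < e / (cmod k + 1)"
      using close[OF c F(1,2), of "e / (cmod k + 1)"] by (auto simp: add_nonneg_pos)
    define P where "P = (\<lambda>x. \<Sum>p\<in>F. p x)"
    have P: "seminorm_on UNIV P" unfolding P_def using F Q by (intro seminorm_on_sum) auto
    have "P (smultC k x - smultC k c) = cmod k * P (x - c)"
      using seminorm_smultC[OF subalgebra_UNIV P, of "x - c" k]
      by (simp add: smultC_conv_mult[of k x] smultC_conv_mult[of k c] smultC_conv_mult[of k "x - c"] algebra_simps)
    also have "\<dots> \<le> (cmod k + 1) * P (x - c)"
      using seminorm_nonneg[OF subalgebra_UNIV P] by (intro mult_right_mono) auto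
    also have "\<dots> < e"
      using x(2) add_nonneg_pos[OF norm_ge_zero[of k] zero_less_one]
      by (simp add: P_def pos_less_divide_eq mult.commute)
    finally show "\<exists>x\<in>D. (\<Sum>p\<in>F. p (x - smultC k c)) < e" using x cd by (auto simp: P_def)
  qed
  assume d: "d \<in> ?C"
  show "c + d \<in> ?C"
  proof (rule closeI)
    fix F e assume F: "finite F" "F \<subseteq> Q" "(0::real) < e"
    define P where "P = (\<lambda>x. \<Sum>p\<in>F. p x)"
    have P: "seminorm_on UNIV P" unfolding P_def using F Q by (intro seminorm_on_sum) auto
    obtain x where x: "x \<in> D" "P (x - c) < e / 2" using close[OF c F(1,2), of "e / 2"] F by (auto simp: P_def)
    obtain y where y: "y \<in> D" "P (y - d) < e / 2" using close[OF d F(1,2), of "e / 2"] F by (auto simp: P_def)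
    have "P (x + y - (c + d)) < e"
      using seminorm_add[OF subalgebra_UNIV P, of "x - c" "y - d"] x y by (simp add: algebra_simps)
    then show "\<exists>x\<in>D. (\<Sum>p\<in>F. p (x - (c + d))) < e" using x y cd by (auto simp: P_def)
  qed
  show "c * d \<in> ?C"
  proof (rule closeI)
    fix F e assume F: "finite F" "F \<subseteq> Q" "(0::real) < e"
    define P where "P = (\<lambda>x. \<Sum>p\<in>F. p x)"
    have P: "seminorm_on UNIV P" unfolding P_def using F Q by (intro seminorm_on_sum) auto
    have smP: "submultiplicative_on UNIV P"
      unfolding P_def using F Q sm by (intro submultiplicative_on_sum) auto
    have nn: "0 \<le> P a" for a using seminorm_nonneg[OF subalgebra_UNIV P] by simp
    \<comment> \<open>The bound 1 makes the quadratic term at most \<open>r\<close>; the total is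
      then below \<open>r * (2 + P c + P d)\<close>, hence below \<open>e\<close>.\<close>
    define r where "r = min 1 (e / (2 + P c + P d))"
    have pos: "0 < 2 + P c + P d" using nn[of c] nn[of d] by linarith
    then have r: "0 < r" "r \<le> 1" using F by (auto simp: r_def)
    have re: "r * (2 + P c + P d) \<le> e"
      unfolding pos_le_divide_eq[OF pos, symmetric] by (simp add: r_def)
    obtain x where x: "x \<in> D" "P (x - c) < r" using close[OF c F(1,2) r(1)] by (auto simp: P_def)
    obtain y where y: "y \<in> D" "P (y - d) < r" using close[OF d F(1,2) r(1)] by (auto simp: P_def)
    have "P (x * y - c * d) \<le> P (x - c) * P (y - d) + (P (x - c) * P d + P c * P (y - d))"
      by (rule seminorm_mult_diff_le[OF subalgebra_UNIV P smP]) auto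
    also have "\<dots> \<le> r * 1 + (r * P d + P c * r)"
      using x(2) y(2) r nn by (intro add_mono mult_mono) auto
    also have "\<dots> < r * (2 + P c + P d)" using r by (simp add: algebra_simps)
    finally have "P (x * y - c * d) < e" using re by simp
    then show "\<exists>x\<in>D. (\<Sum>p\<in>F. p (x - c * d)) < e" using x y cd by (auto simp: P_def)
  qed
qed

text \<open>By linearity, domination by a finite sum of defining seminorms bounds
  \<open>\<bar>h y - h x\<bar>\<close> by the same sum at \<open>y - x\<close>.\<close>

lemma Mstar_continuous:
  assumes S: "subalgebra S" and F: "finite F" "F \<subseteq> Q" and h: "h \<in> Mstar S"
    and le: "\<And>x. x \<in> S \<Longrightarrow> cmod (h x) \<le> (\<Sum>p\<in>F. p x)"
  shows "h \<in> Mcont S (subtopology (seminorm_topology UNIV Q) S)"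
  unfolding Mcont_def continuous_map_def
proof (intro CollectI conjI h allI impI)
  let ?T = "seminorm_topology UNIV Q"
  show "h \<in> topspace (subtopology ?T S) \<rightarrow> topspace euclidean" by simp
  fix U :: "complex set" assume "openin euclidean U"
  then have U: "open U" by simp
  show "openin (subtopology ?T S) {x \<in> topspace (subtopology ?T S). h x \<in> U}"
  proof (subst openin_subopen, intro ballI)
    fix x assume "x \<in> {x \<in> topspace (subtopology ?T S). h x \<in> U}"
    then have x: "x \<in> S" "h x \<in> U" by auto
    then obtain e where e: "0 < e" "ball (h x) e \<subseteq> U" using U open_contains_ball by blast
    define B where "B = {y. (\<Sum>p\<in>F. p (y - x)) < e}"
    have "openin (subtopology ?T S) (B \<inter> S)"
      using sum_ball_open[OF F] by (auto simp: openin_subtopology B_def)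
    moreover have "x \<in> B" using e F sum_seminorms_zero by (simp add: B_def)
    moreover have "h y \<in> U" if "y \<in> B" "y \<in> S" for y
    proof -
      have "cmod (h y - h x) < e"
        using le[of "y - x"] that x subalgebra_closed[OF S] Mstar_diff[OF S h, of y x] by (simp add: B_def)
      then show ?thesis using e by (auto simp: dist_norm norm_minus_commute)
    qed
    ultimately show "\<exists>T. openin (subtopology ?T S) T \<and> x \<in> T \<and> T \<subseteq> {x \<in> topspace (subtopology ?T S). h x \<in> U}"
      using x by (intro exI[of _ "B \<inter> S"]) (auto simp: topspace_seminorm_topology)
  qed
qed

end

section \<open>The equivalence\<close>

text \<open>A neighbourhood of 0 that misses \<open>x\<close> contains a finite intersection of
  seminorm balls, and \<open>x\<close> must violate one of the inequalities.\<close>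

lemma seminorm_separates:
  assumes "Hausdorff_space (seminorm_topology UNIV Q)" and Q: "\<forall>p\<in>Q. seminorm_on UNIV p"
    and x: "x \<noteq> 0"
  obtains p where "p \<in> Q" "0 < p x"
proof -
  obtain U V where U: "openin (seminorm_topology UNIV Q) U" "0 \<in> U" and V: "x \<in> V" "disjnt U V"
    using assms(1) x topspace_seminorm_topology[OF Q] unfolding Hausdorff_space_def by (metis UNIV_I)
  obtain F e where F: "F \<subseteq> Q" "0 < e" "{y\<in>UNIV. \<forall>p\<in>F. p (y - 0) < e} \<subseteq> U"
    using U unfolding openin_seminorm_topology by blast
  have "x \<notin> U" using V by (auto simp: disjnt_def)
  then have "\<not> (\<forall>p\<in>F. p x < e)" using F(3) by auto
  then obtain p where "p \<in> F" "e \<le> p x" by (auto simp: not_less)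
  then show thesis using that[of p] F by auto
qed

text \<open>The set is an intersection, over \<open>x\<close>, of preimages of closed half-lines
  under the weak* continuous maps \<open>h \<mapsto> \<bar>h x\<bar>\<close>.\<close>

lemma closedin_dominated_characters:
  "closedin (weak_star_topology UNIV T) {h \<in> Mcont UNIV T. \<forall>x. cmod (h x) \<le> b x}"
proof -
  let ?W = "weak_star_topology UNIV T"
  have top: "topspace ?W = Mcont UNIV T"
    by (auto simp: weak_star_topology_def topspace_pullback_topology)
  have "closedin ?W {h \<in> topspace ?W. cmod (h x) \<in> {..b x}}" for x
  proof (rule closedin_continuous_map_preimage)
    have "continuous_map ?W euclidean ((\<lambda>k. k x) \<circ> (\<lambda>f. restrict f UNIV))"
      unfolding weak_star_topology_def
      by (intro continuous_map_pullback continuous_map_product_projection) simp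
    then have "continuous_map ?W euclidean (\<lambda>h. h x)" by (simp add: o_def)
    then show "continuous_map ?W euclidean (\<lambda>h. cmod (h x))"
      by (intro continuous_map_norm)
  qed simp
  then have "closedin ?W (\<Inter>x. {h \<in> topspace ?W. cmod (h x) \<in> {..b x}})"
    by (intro closedin_Inter) auto
  moreover have "(\<Inter>x. {h \<in> topspace ?W. cmod (h x) \<in> {..b x}}) = {h \<in> Mcont UNIV T. \<forall>x. cmod (h x) \<le> b x}"
    by (auto simp: top)
  ultimately show ?thesis by simp
qed

section \<open>Transport of characters along the homomorphism\<close>

lemma Mstar_comp_hom:
  assumes "alg_hom \<Phi>" "range \<Phi> \<subseteq> S" "subalgebra S" "f \<in> Mstar S"
  shows "f \<circ> \<Phi> \<in> Mstar UNIV"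
proof -
  have "f (\<Phi> 1) \<noteq> 0" using assms Mstar_one[of S f] by (simp add: alg_hom_def)
  moreover have "\<Phi> x \<in> S" for x using assms(2) by auto
  ultimately show ?thesis
    using assms(1,4) unfolding Mstar_def alg_hom_def by (auto intro!: exI[of _ 1])
qed

lemma Mstar_comp_inv:
  assumes h: "alg_hom \<Phi>" and inj: "inj \<Phi>" and g: "g \<in> Mstar UNIV"
  shows "g \<circ> inv \<Phi> \<in> Mstar (range \<Phi>)"
proof -
  have inv: "inv \<Phi> (\<Phi> x) = x" for x using inj by simp
  have hom: "\<Phi> x + \<Phi> y = \<Phi> (x + y)" "\<Phi> x * \<Phi> y = \<Phi> (x * y)" "smultC c (\<Phi> x) = \<Phi> (smultC c x)" for x y c
    using h by (auto simp: alg_hom_def)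
  obtain x where "g x \<noteq> 0" using g by (auto simp: Mstar_def)
  then have "(g \<circ> inv \<Phi>) (\<Phi> x) \<noteq> 0" by (simp add: inv)
  then show ?thesis
    using Mstar_add[OF g] Mstar_mult[OF g] Mstar_smultC[OF g]
    unfolding Mstar_def by (auto simp: hom inv)
qed

lemma subalgebra_range:
  assumes "alg_hom \<Phi>"
  shows "subalgebra (range \<Phi>)"
proof -
  have hom: "\<Phi> x + \<Phi> y = \<Phi> (x + y)" "\<Phi> x * \<Phi> y = \<Phi> (x * y)" "smultC c (\<Phi> x) = \<Phi> (smultC c x)" "1 = \<Phi> 1" for x y c
    using assms by (auto simp: alg_hom_def)
  show ?thesis unfolding subalgebra_def using hom(4) by (auto simp: hom(1-3))
qed

theorem theorem3p1:
  fixes TA :: "'a::calg topology" and TB :: "'b::calg topology" and \<Phi> :: "'a \<Rightarrow> 'b"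
  assumes "uT_algebra UNIV TA" and "weakly_regular UNIV TA" and "functionally_continuous UNIV TA"
    and "lmc_algebra UNIV TB"
    and "alg_hom \<Phi>" and "inj \<Phi>"
    and "q_algebra (TB closure_of range \<Phi>) (subtopology TB (TB closure_of range \<Phi>))"
  shows "(continuous_map (subtopology TB (range \<Phi>)) TA (inv \<Phi>)
          \<longleftrightarrow> functionally_continuous (range \<Phi>) (subtopology TB (range \<Phi>)))
       \<and> (functionally_continuous (range \<Phi>) (subtopology TB (range \<Phi>))
          \<longleftrightarrow> (\<forall>g\<in>Mcont UNIV TA. \<exists>f\<in>Mcont (TB closure_of range \<Phi>)
                   (subtopology TB (TB closure_of range \<Phi>)). g = f \<circ> \<Phi>))
       \<and> ((\<forall>g\<in>Mcont UNIV TA. \<exists>f\<in>Mcont (TB closure_of range \<Phi>)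
                   (subtopology TB (TB closure_of range \<Phi>)). g = f \<circ> \<Phi>)
          \<longleftrightarrow> range \<Phi> \<inter> jacobson_radical (TB closure_of range \<Phi>) = {0})"
proof -

  \<comment> \<open>The image \<open>D\<close> and its closure \<open>C\<close>\<close>
  define C where "C = TB closure_of range \<Phi>"
  define D where "D = range \<Phi>"
  have hom: "\<Phi> (x + y) = \<Phi> x + \<Phi> y" for x y
    using assms(5) by (auto simp: alg_hom_def)
  have inv: "inv \<Phi> (\<Phi> x) = x" for x using assms(6) by simp
  have \<Phi>0: "\<Phi> 0 = 0" using hom[of 0 0] by simp
  have \<Phi>diff: "\<Phi> (x - y) = \<Phi> x - \<Phi> y" for x y using hom[of "x - y" y] by (simp add: algebra_simps)
  obtain QA where QA: "\<And>p. p \<in> QA \<Longrightarrow> seminorm_on UNIV p" "\<And>p. p \<in> QA \<Longrightarrow> uniform_on UNIV p"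
    and TA: "TA = seminorm_topology UNIV QA" and HA: "Hausdorff_space TA"
    using assms(1) by (auto simp: uT_algebra_def topological_algebra_def)
  have QA': "\<forall>p\<in>QA. seminorm_on UNIV p" using QA(1) by blast
  obtain Q where Q: "\<forall>p\<in>Q. seminorm_on UNIV p" and Qm: "\<And>p. p \<in> Q \<Longrightarrow> submultiplicative_on UNIV p"
    and TB: "TB = seminorm_topology UNIV Q"
    using assms(4) by (auto simp: lmc_algebra_def)
  have MA: "Mstar UNIV = Mcont UNIV TA" using assms(3) by (simp add: functionally_continuous_def)
  have D: "subalgebra D" unfolding D_def by (rule subalgebra_range[OF assms(5)])
  have C: "subalgebra C" unfolding C_def TB by (rule subalgebra_closure[OF Q D[unfolded D_def] Qm])
  have DC: "D \<subseteq> C" unfolding C_def D_def TB by (rule subset_seminorm_closure[OF Q])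
  have \<Phi>D: "\<Phi> x \<in> D" and \<Phi>C: "\<Phi> x \<in> C" for x using DC by (auto simp: D_def)
  note cl = subalgebra_closed[OF C]
  have sumQ: "seminorm_on S (\<lambda>x. \<Sum>p\<in>F. p x)" "submultiplicative_on S (\<lambda>x. \<Sum>p\<in>F. p x)"
    if "finite F" "F \<subseteq> Q" for S F
    using that seminorm_on_subset[OF seminorm_on_sum[of F UNIV]]
      submultiplicative_on_subset[OF submultiplicative_on_sum[of F UNIV]] Q Qm
    by (auto simp: subset_iff)

  \<comment> \<open>A continuous seminorm controlling invertibility in \<open>C\<close>\<close>
  obtain F0 e0 where F0: "finite F0" "F0 \<subseteq> Q" and e0: "0 < e0"
    and inv0: "\<And>x. x \<in> C \<Longrightarrow> (\<Sum>p\<in>F0. p x) < e0 \<Longrightarrow> \<exists>y\<in>C. (1 - x) * y = 1"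
  proof -
    have "openin (subtopology TB C) {x\<in>C. \<exists>y\<in>C. x * y = 1}"
      using assms(7) by (simp add: q_algebra_def C_def)
    then obtain T where T: "openin TB T" "{x\<in>C. \<exists>y\<in>C. x * y = 1} = T \<inter> C"
      by (auto simp: openin_subtopology)
    \<comment> \<open>The open set of units contains a seminorm ball about 1; this ball is then
      translated to the origin.\<close>
    have "1 \<in> {x\<in>C. \<exists>y\<in>C. x * y = 1}" using cl(1) by force
    then have "1 \<in> T" using T by blast
    then obtain F e where F: "finite F" "F \<subseteq> Q" "0 < e" "{y. (\<Sum>p\<in>F. p (y - 1)) < e} \<subseteq> T"
      using open_contains_sum_ball[OF Q, of T 1] T TB by auto
    have "\<exists>y\<in>C. (1 - x) * y = 1" if x: "x \<in> C" "(\<Sum>p\<in>F. p x) < e" for x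
    proof -
      have "(\<Sum>p\<in>F. p (- x)) = (\<Sum>p\<in>F. p x)"
        using seminorm_minus[OF C sumQ(1)[OF F(1,2)] x(1)] .
      then have "1 - x \<in> T \<inter> C" using F(4) x cl(1,7) by (auto simp: subset_iff)
      then show ?thesis unfolding T(2)[symmetric] by simp
    qed
    then show thesis by (rule that[OF F(1-3)])
  qed
  define P where "P = (\<lambda>x. \<Sum>p\<in>F0. p x)"
  have P: "seminorm_on S P" "submultiplicative_on S P" for S
    unfolding P_def using sumQ[OF F0] by auto
  have inv1: "\<exists>y\<in>C. (1 - x) * y = 1" if "x \<in> C" "P x < e0" for x
    using inv0[of x] that by (simp add: P_def)
  \<comment> \<open>If \<open>f z = 1\<close>, then \<open>f (1 - z) = 0\<close>, so
    \<open>1 - z\<close> is not invertible; this excludes the value 1 on the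
    \<open>e0\<close>-ball.\<close>
  have bound: "cmod (f x) \<le> P x" if f: "f \<in> Mstar C" and x: "x \<in> C" for f x
  proof (rule Mstar_le_seminorm[OF C f P e0 _ x])
    fix z assume z: "z \<in> C" "P z < e0"
    then obtain y where y: "y \<in> C" "(1 - z) * y = 1" using inv1[of z] by auto
    then have "f (1 - z) * f y = 1"
      using Mstar_mult[OF f, of "1 - z" y] Mstar_one[OF C f] z cl by simp
    then show "f z \<noteq> 1" using Mstar_diff[OF C f cl(1) z(1)] Mstar_one[OF C f] by auto
  qed

  \<comment> \<open>Dominated characters of \<open>A\<close> come from characters of
    \<open>C\<close>\<close>
  have extend: "\<exists>f\<in>Mcont C (subtopology TB C). g = f \<circ> \<Phi>"
    if g: "g \<in> Mstar UNIV" and F: "finite F" "F \<subseteq> Q" and le: "\<And>x. cmod (g x) \<le> (\<Sum>p\<in>F. p (\<Phi> x))" for g F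
  proof -
    have g': "g \<circ> inv \<Phi> \<in> Mstar D" unfolding D_def by (rule Mstar_comp_inv[OF assms(5,6) g])
    have dense: "\<exists>x\<in>D. (\<Sum>p\<in>F. p (x - c)) < e" if "c \<in> C" "0 < e" for c e
      using that(1)[unfolded C_def TB in_closure_iff_sum_ball[OF Q], rule_format, of F e] F that(2)
      by (simp add: D_def)
    have le': "cmod ((g \<circ> inv \<Phi>) x) \<le> (\<Sum>p\<in>F. p x)" if "x \<in> D" for x
      using that le by (auto simp: D_def inv)
    obtain f where f: "f \<in> Mstar C" "\<And>x. x \<in> D \<Longrightarrow> f x = (g \<circ> inv \<Phi>) x"
      "\<And>c. c \<in> C \<Longrightarrow> cmod (f c) \<le> (\<Sum>p\<in>F. p c)"
      using Mstar_extension[OF C D DC sumQ[OF F] dense g' le'] by auto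
    have "f \<in> Mcont C (subtopology TB C)" unfolding TB by (rule Mstar_continuous[OF Q C F f(1,3)])
    moreover have "g = f \<circ> \<Phi>" using f(2)[OF \<Phi>D] by (auto simp: inv)
    ultimately show ?thesis by blast
  qed

  let ?s1 = "continuous_map (subtopology TB D) TA (inv \<Phi>)"
  let ?s2 = "functionally_continuous D (subtopology TB D)"
  let ?s3 = "\<forall>g\<in>Mcont UNIV TA. \<exists>f\<in>Mcont C (subtopology TB C). g = f \<circ> \<Phi>"
  let ?s4 = "D \<inter> jacobson_radical C = {0}"

  \<comment> \<open>Continuity of the inverse implies functional continuity of the image\<close>
  have 12: ?s2 if s1: ?s1
  proof -
    \<comment> \<open>On \<open>D\<close>, \<open>f\<close> is the composition of the continuous
      inverse with \<open>f \<circ> \<Phi>\<close>, which is continuous because \<open>A\<close> is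
      functionally continuous.\<close>
    have "f \<in> Mcont D (subtopology TB D)" if f: "f \<in> Mstar D" for f
    proof -
      have "f \<circ> \<Phi> \<in> Mcont UNIV TA"
        using Mstar_comp_hom[OF assms(5) _ D f] MA by (simp add: D_def)
      then have "continuous_map TA euclidean (f \<circ> \<Phi>)" by (simp add: Mcont_def)
      from continuous_map_compose[OF s1 this]
      have "continuous_map (subtopology TB D) euclidean f"
        by (rule continuous_map_eq) (auto simp: D_def inv)
      then show ?thesis using f by (simp add: Mcont_def)
    qed
    then show ?thesis by (auto simp: functionally_continuous_def Mcont_def)
  qed

  \<comment> \<open>Functional continuity of the image implies surjectivity\<close>
  have 23: ?s3 if s2: ?s2
  proof
    fix g assume "g \<in> Mcont UNIV TA"
    then have g: "g \<in> Mstar UNIV" using MA by simp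
    have g': "g \<circ> inv \<Phi> \<in> Mstar D" unfolding D_def by (rule Mstar_comp_inv[OF assms(5,6) g])
    then have "continuous_map (subtopology TB D) euclidean (g \<circ> inv \<Phi>)"
      using s2 by (auto simp: functionally_continuous_def Mcont_def)
    \<comment> \<open>The preimage of the open unit disc is a neighbourhood of 0 on which the
      character never takes the value 1, as \<open>Mstar_le_seminorm\<close> requires.\<close>
    then have "openin (subtopology TB D) {x \<in> topspace (subtopology TB D). (g \<circ> inv \<Phi>) x \<in> ball 0 1}"
      by (rule openin_continuous_map_preimage) simp
    then have "openin (subtopology TB D) {x \<in> D. (g \<circ> inv \<Phi>) x \<in> ball 0 1}"
      by (simp add: TB topspace_seminorm_topology[OF Q])
    then obtain T where T: "openin TB T" "{x \<in> D. (g \<circ> inv \<Phi>) x \<in> ball 0 1} = T \<inter> D"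
      by (auto simp: openin_subtopology)
    have "0 \<in> {x \<in> D. (g \<circ> inv \<Phi>) x \<in> ball 0 1}"
      using subalgebra_zero[OF D] Mstar_zero[OF D g'] by simp
    then have "0 \<in> T" using T by blast
    then obtain F e where F: "finite F" "F \<subseteq> Q" "0 < e" "{y. (\<Sum>p\<in>F. p (y - 0)) < e} \<subseteq> T"
      using open_contains_sum_ball[OF Q, of T 0] T TB by auto
    have "cmod ((g \<circ> inv \<Phi>) x) \<le> (\<Sum>p\<in>F. p x)" if x: "x \<in> D" for x
    proof (rule Mstar_le_seminorm[OF D g' sumQ[OF F(1,2)] F(3) _ x])
      fix z assume z: "z \<in> D" "(\<Sum>p\<in>F. p z) < e"
      then have "z \<in> T \<inter> D" using F(4) by auto
      then have "cmod ((g \<circ> inv \<Phi>) z) < 1" unfolding T(2)[symmetric] by simp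
      then show "(g \<circ> inv \<Phi>) z \<noteq> 1" by auto
    qed
    from this[OF \<Phi>D] show "\<exists>f\<in>Mcont C (subtopology TB C). g = f \<circ> \<Phi>"
      by (intro extend[OF g F(1,2)]) (simp add: inv)
  qed

  \<comment> \<open>Surjectivity implies continuity of the inverse\<close>
  have 31: ?s1 if s3: ?s3
  proof -
    \<comment> \<open>A character \<open>g\<close> with \<open>\<bar>g x\<bar> = p x\<close> is
      lifted to \<open>C\<close>, where \<open>bound\<close> applies. The same \<open>P\<close>
      serves for every defining seminorm \<open>p\<close> of \<open>A\<close>.\<close>
    have dom: "p x \<le> P (\<Phi> x)" if p: "p \<in> QA" for p x
    proof (cases "0 < p x")
      case True
      obtain g where g: "g \<in> Mstar UNIV" "cmod (g x) = p x"
        using uniform_seminorm_character[OF subalgebra_UNIV QA[OF p] UNIV_I True] by metis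
      then obtain f where f: "f \<in> Mcont C (subtopology TB C)" "g = f \<circ> \<Phi>" using s3 MA by blast
      then show ?thesis using bound[of f "\<Phi> x"] g \<Phi>C by (simp add: Mcont_def)
    next
      case False
      then show ?thesis using seminorm_nonneg[OF subalgebra_UNIV P(1), of "\<Phi> x"] by simp
    qed
    have topD: "topspace (subtopology TB D) = D" by (simp add: TB topspace_seminorm_topology[OF Q])
    show ?thesis
      unfolding continuous_map_def topD
    proof (intro conjI allI impI)
      show "inv \<Phi> \<in> D \<rightarrow> topspace TA" by (simp add: TA topspace_seminorm_topology[OF QA'])
      fix U assume U: "openin TA U"
      show "openin (subtopology TB D) {y \<in> D. inv \<Phi> y \<in> U}"
      proof (subst openin_subopen, intro ballI)
        fix y assume "y \<in> {y \<in> D. inv \<Phi> y \<in> U}"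
        then obtain x where x: "y = \<Phi> x" "x \<in> U" by (auto simp: D_def inv)
        obtain F e where F: "F \<subseteq> QA" "0 < e" "{z\<in>UNIV. \<forall>p\<in>F. p (z - x) < e} \<subseteq> U"
          using U x unfolding TA openin_seminorm_topology by blast
        define B where "B = {z. (\<Sum>p\<in>F0. p (z - y)) < e}"
        have "openin (subtopology TB D) (B \<inter> D)"
          using sum_ball_open[OF Q F0, of y e] by (auto simp: openin_subtopology B_def TB)
        moreover have "y \<in> B \<inter> D"
          using F(2) sum_seminorms_zero[OF Q F0(2)] x \<Phi>D by (simp add: B_def)
        moreover have "B \<inter> D \<subseteq> {y \<in> D. inv \<Phi> y \<in> U}"
        proof
          fix z assume z: "z \<in> B \<inter> D"
          then obtain w where w: "z = \<Phi> w" by (auto simp: D_def)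
          have "P (\<Phi> (w - x)) < e" using z by (simp add: B_def P_def \<Phi>diff w x)
          then have "p (w - x) < e" if "p \<in> F" for p
            using dom[of p "w - x"] that F(1) by (meson order_le_less_trans subsetD)
          then have "w \<in> U" using F(3) by (auto simp: subset_iff)
          then show "z \<in> {y \<in> D. inv \<Phi> y \<in> U}" using z w by (simp add: inv)
        qed
        ultimately show "\<exists>T. openin (subtopology TB D) T \<and> y \<in> T \<and> T \<subseteq> {y \<in> D. inv \<Phi> y \<in> U}" by blast
      qed
    qed
  qed

  \<comment> \<open>Surjectivity implies trivial intersection with the radical\<close>
  have 34: ?s4 if s3: ?s3
  proof
    show "{0} \<subseteq> D \<inter> jacobson_radical C"
      using subalgebra_zero[OF D] cl(2) by (auto simp: jacobson_radical_def maximal_ideal_def alg_ideal_def)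
    show "D \<inter> jacobson_radical C \<subseteq> {0}"
    proof
      fix y assume "y \<in> D \<inter> jacobson_radical C"
      then obtain x where x: "y = \<Phi> x" and rad: "\<Phi> x \<in> jacobson_radical C" by (auto simp: D_def)
      have "x = 0"
      proof (rule ccontr)
        assume "x \<noteq> 0"
        then obtain p where p: "p \<in> QA" "0 < p x"
          using seminorm_separates[OF HA[unfolded TA] QA'] by metis
        \<comment> \<open>The character that detects \<open>x\<close> lifts to \<open>C\<close>; the
          kernel of the lift is a maximal ideal that misses \<open>\<Phi> x\<close>.\<close>
        obtain g where g: "g \<in> Mstar UNIV" "cmod (g x) = p x"
          using uniform_seminorm_character[OF subalgebra_UNIV QA[OF p(1)] UNIV_I p(2)] by metis
        then obtain f where f: "f \<in> Mcont C (subtopology TB C)" "g = f \<circ> \<Phi>" using s3 MA by blast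
        then have "maximal_ideal C {z\<in>C. f z = 0}" by (intro Mstar_kernel_maximal[OF C]) (simp add: Mcont_def)
        then have "f (\<Phi> x) = 0" using rad by (auto simp: jacobson_radical_def)
        then show False using g f p by simp
      qed
      then show "y \<in> {0}" using x \<Phi>0 by simp
    qed
  qed

  \<comment> \<open>Trivial intersection with the radical implies surjectivity\<close>
  have 43: ?s3 if s4: ?s4
  proof (rule ccontr)
    assume not3: "\<not> ?s3"
    \<comment> \<open>All elements of this closed set lift by \<open>extend\<close>, so the failure
      of surjectivity makes it proper and weak regularity applies.\<close>
    define F where "F = {h \<in> Mcont UNIV TA. \<forall>x. cmod (h x) \<le> P (\<Phi> x)}"
    have "F \<noteq> Mcont UNIV TA"
    proof
      assume eq: "F = Mcont UNIV TA"
      have ?s3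
      proof
        fix g assume g: "g \<in> Mcont UNIV TA"
        then have "g \<in> F" using eq by simp
        then show "\<exists>f\<in>Mcont C (subtopology TB C). g = f \<circ> \<Phi>"
          using g MA by (intro extend[OF _ F0]) (auto simp: F_def P_def)
      qed
      then show False using not3 by contradiction
    qed
    moreover have "closedin (weak_star_topology UNIV TA) F"
      unfolding F_def by (rule closedin_dominated_characters)
    ultimately obtain x where x: "x \<noteq> 0" and Fx: "\<forall>h\<in>F. h x = 0"
      using assms(2)[unfolded weakly_regular_def, rule_format, of F] by auto
    \<comment> \<open>Each maximal ideal of \<open>C\<close> is the kernel of a character
      \<open>f\<close>. By \<open>bound\<close>, \<open>f \<circ> \<Phi>\<close> lies in
      \<open>F\<close>, so it vanishes at \<open>x\<close>.\<close>
    have "\<Phi> x \<in> I" if I: "maximal_ideal C I" for I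
    proof -
      have I': "alg_ideal C I" "I \<noteq> C" using I by (auto simp: maximal_ideal_def)
      obtain f where f: "f \<in> Mstar C" "\<And>i. i \<in> I \<Longrightarrow> f i = 0"
        using proper_ideal_character[OF C P e0 inv1 I'] by metis
      have "f \<circ> \<Phi> \<in> Mcont UNIV TA"
        using Mstar_comp_hom[OF assms(5) _ C f(1)] DC MA by (simp add: D_def)
      then have "f \<circ> \<Phi> \<in> F" using bound[OF f(1) \<Phi>C] by (simp add: F_def)
      then have "f (\<Phi> x) = 0" using bspec[OF Fx, of "f \<circ> \<Phi>"] by simp
      moreover have "{z\<in>C. f z = 0} = I"
      proof -
        have k: "maximal_ideal C {z\<in>C. f z = 0}" by (rule Mstar_kernel_maximal[OF C f(1)])
        have "I \<subseteq> {z\<in>C. f z = 0}" using f(2) I' by (auto simp: alg_ideal_def)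
        then show ?thesis using I k unfolding maximal_ideal_def by metis
      qed
      ultimately show ?thesis using \<Phi>C by blast
    qed
    then have "\<Phi> x \<in> D \<inter> jacobson_radical C" using \<Phi>C \<Phi>D by (simp add: jacobson_radical_def)
    then have "\<Phi> x = \<Phi> 0" using s4 \<Phi>0 by simp
    then show False using assms(6) x by (simp add: inj_eq)
  qed

  \<comment> \<open>The first three conditions are linked in a cycle, and the fourth is equivalent
    to the third.\<close>
  have "(?s1 \<longleftrightarrow> ?s2) \<and> (?s2 \<longleftrightarrow> ?s3) \<and> (?s3 \<longleftrightarrow> ?s4)"
    using 12 23 31 34 43 by argo
  then show ?thesis by (simp only: C_def D_def)
qed

end
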